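(* Let $\mathbb{K}$ be a field of characteristic zero, $G$ an abelian group, $\varepsilon$ an antisymmetric bicharacter on $G$, $L$ a $G$-graded $\varepsilon$-Lie algebra over $\mathbb{K}$, and $\{x_i\}_{i\in I}$ a $G$-homogeneous basis of $L$, where $I$ is a well-ordered set. Let $\omega\in\mathrm{Z}^2_{gr}(L,\mathbb{K})$ be any scalar graded 2-cocycle, and let $z_i\in U_\omega(L)$ denote the canonical image of $x_i$. Then the set of ordered monomials $z_{i_1}\cdots z_{i_n}$, $n\in\mathbb{N}$, where $i_j\le i_{j+1}$, and $i_j<i_{j+1}$ if $\varepsilon(g_j,g_j)\ne1$ with $x_{i_j}\in L_{g_j}$, forms a basis of $U_\omega(L)$.
   Context: $G$ is written multiplicatively with identity $e$; $\mathbb{N}$ contains $0$, and the empty monomial ($n=0$) is $1$; $|a|$ denotes the degree of a homogeneous element. An antisymmetric bicharacter is a map $\varepsilon:G\times G\to\mathbb{K}^\times$ with $\varepsilon(g,h)\varepsilon(h,g)=1$, $\varepsilon(g,hk)=\varepsilon(g,h)\varepsilon(g,k)$, $\varepsilon(gh,k)=\varepsilon(g,k)\varepsilon(h,k)$. A $G$-graded $\varepsilon$-Lie algebra (color Lie algebra) is a $G$-graded $\mathbb{K}$-space $L=\bigoplus_{g\in G}L_g$ with a bilinear bracket such that $[L_g,L_h]\subseteq L_{gh}$, $[a,b]=-\varepsilon(|a|,|b|)[b,a]$ and $\varepsilon(|c|,|a|)[a,[b,c]]+\varepsilon(|a|,|b|)[b,[c,a]]+\varepsilon(|b|,|c|)[c,[a,b]]=0$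 for homogeneous $a,b,c$. $\mathrm{Z}^2_{gr}(L,\mathbb{K})$ is the space of scalar graded 2-cocycles of degree zero: bilinear maps $\omega:L\times L\to\mathbb{K}$ with $\omega(L_g,L_h)=0$ unless $gh=e$, $\omega(x,y)=-\varepsilon(|x|,|y|)\omega(y,x)$, and $\varepsilon(|z|,|x|)\omega(x,[y,z])+\varepsilon(|x|,|y|)\omega(y,[z,x])+\varepsilon(|y|,|z|)\omega(z,[x,y])=0$ for homogeneous $x,y,z$. The generalized enveloping algebra $U_\omega(L)$ is the quotient of the tensor algebra $T(L)$ by the $G$-graded two-sided ideal generated by all $v_1\otimes v_2-\varepsilon(|v_1|,|v_2|)v_2\otimes v_1-[v_1,v_2]-\omega(v_1,v_2)$ with $v_1,v_2\in L$ homogeneous. *)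

theory Defs
  imports
    "HOL-Library.Poly_Mapping"
    "HOL-Algebra.Algebraic_Closure_Type"
    "Jordan_Normal_Form.Missing_VectorSpace"
begin

section \<open>Color Lie algebras and scalar cocycles\<close>

text \<open>
  The abelian group \<open>G\<close> is a type of class \<^class>\<open>ab_group_add\<close>, hence written additively:
  \<open>g + h\<close> stands for \<open>gh\<close> and \<open>0\<close> for the identity \<open>e\<close>.
  Statements about the degree \<open>|a|\<close> of a homogeneous \<open>a\<close> are phrased as
  ``for all \<open>g\<close> with \<open>a \<in> L g\<close>''; for \<open>a = 0\<close> they are trivial for each such \<open>g\<close>.
\<close>

definition antisymmetric_bicharacter :: "('g::ab_group_add \<Rightarrow> 'g \<Rightarrow> 'k::field) \<Rightarrow> bool" where
  "antisymmetric_bicharacter \<epsilon> \<longleftrightarrow>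
     (\<forall>g h. \<epsilon> g h \<noteq> 0) \<and>
     (\<forall>g h. \<epsilon> g h * \<epsilon> h g = 1) \<and>
     (\<forall>g h k. \<epsilon> g (h + k) = \<epsilon> g h * \<epsilon> g k) \<and>
     (\<forall>g h k. \<epsilon> (g + h) k = \<epsilon> g k * \<epsilon> h k)"

locale graded_vector_space = vector_space scale
  for scale :: "'k::field \<Rightarrow> 'l::ab_group_add \<Rightarrow> 'l" +
  fixes L :: "'g::ab_group_add \<Rightarrow> 'l set"
  assumes subspace_component: "\<And>g. subspace (L g)"
    and direct_sum: "\<And>x. \<exists>!f :: 'g \<Rightarrow> 'l.
          finite {g. f g \<noteq> 0} \<and> (\<forall>g. f g \<in> L g) \<and> x = (\<Sum>g | f g \<noteq> 0. f g)"
begin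

text \<open>The index set \<open>I\<close> is a subset of a type, so that \<open>I = {}\<close> (i.e.\ \<open>L = 0\<close>) is allowed.\<close>

definition homogeneous_basis :: "'i set \<Rightarrow> ('i \<Rightarrow> 'l) \<Rightarrow> ('i \<Rightarrow> 'g) \<Rightarrow> bool" where
  "homogeneous_basis I x d \<longleftrightarrow>
     inj_on x I \<and> independent (x ` I) \<and> span (x ` I) = UNIV \<and> (\<forall>i\<in>I. x i \<in> L (d i))"

end

locale color_lie_algebra = graded_vector_space scale L
  for scale :: "'k::field \<Rightarrow> 'l::ab_group_add \<Rightarrow> 'l"
    and L :: "'g::ab_group_add \<Rightarrow> 'l set" +
  fixes \<epsilon> :: "'g \<Rightarrow> 'g \<Rightarrow> 'k"
    and br :: "'l \<Rightarrow> 'l \<Rightarrow> 'l"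
  assumes bicharacter: "antisymmetric_bicharacter \<epsilon>"
    and br_linear_left: "\<And>y. Vector_Spaces.linear scale scale (\<lambda>x. br x y)"
    and br_linear_right: "\<And>x. Vector_Spaces.linear scale scale (\<lambda>y. br x y)"
    and br_graded: "\<And>g h a b. a \<in> L g \<Longrightarrow> b \<in> L h \<Longrightarrow> br a b \<in> L (g + h)"
    and br_antisym: "\<And>g h a b. a \<in> L g \<Longrightarrow> b \<in> L h \<Longrightarrow> br a b = - scale (\<epsilon> g h) (br b a)"
    and br_jacobi: "\<And>g h k a b c. a \<in> L g \<Longrightarrow> b \<in> L h \<Longrightarrow> c \<in> L k \<Longrightarrow>
          scale (\<epsilon> k g) (br a (br b c)) + scale (\<epsilon> g h) (br b (br c a))
            + scale (\<epsilon> h k) (br c (br a b)) = 0"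
begin

definition Z2_gr :: "('l \<Rightarrow> 'l \<Rightarrow> 'k) set" where
  "Z2_gr = {\<omega>.
     (\<forall>y. Vector_Spaces.linear scale (*) (\<lambda>x. \<omega> x y)) \<and>
     (\<forall>x. Vector_Spaces.linear scale (*) (\<lambda>y. \<omega> x y)) \<and>
     (\<forall>g h. \<forall>x\<in>L g. \<forall>y\<in>L h. g + h \<noteq> 0 \<longrightarrow> \<omega> x y = 0) \<and>
     (\<forall>g h. \<forall>x\<in>L g. \<forall>y\<in>L h. \<omega> x y = - \<epsilon> g h * \<omega> y x) \<and>
     (\<forall>g h k. \<forall>x\<in>L g. \<forall>y\<in>L h. \<forall>z\<in>L k.
        \<epsilon> k g * \<omega> x (br y z) + \<epsilon> g h * \<omega> y (br z x) + \<epsilon> h k * \<omega> z (br x y) = 0)}"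

end

section \<open>The tensor algebra\<close>

datatype 'a word = Word "'a list"

instantiation word :: (type) monoid_add
begin

definition "0 = Word []"

fun plus_word :: "'a word \<Rightarrow> 'a word \<Rightarrow> 'a word" where
  "Word u + Word v = Word (u @ v)"

instance
proof
  fix a b c :: "'a word"
  show "a + b + c = a + (b + c)" by (cases a; cases b; cases c) simp
  show "0 + a = a" by (cases a) (simp add: zero_word_def)
  show "a + 0 = a" by (cases a) (simp add: zero_word_def)
qed

end

text \<open>
  The free unital associative \<open>K\<close>-algebra \<open>K\<langle>L\<rangle>\<close> on the underlying \<^emph>\<open>set\<close> of \<open>L\<close>: the monoid
  algebra of the monoid of words over \<open>L\<close>, with the convolution product of
  \<^theory>\<open>HOL-Library.Poly_Mapping\<close>.
\<close>

type_synonym ('k, 'l) free_algebra = "'l word \<Rightarrow>\<^sub>0 'k"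

definition free_gen :: "'l \<Rightarrow> ('k::field, 'l) free_algebra" where
  "free_gen v = Poly_Mapping.single (Word [v]) 1"

definition free_scalar :: "'k::field \<Rightarrow> ('k, 'l) free_algebra" where
  "free_scalar c = Poly_Mapping.single 0 c"

abbreviation free_ring :: "('k::field, 'l) free_algebra ring" where
  "free_ring \<equiv> ring_of_type_algebra"

text \<open>
  The ideal generated by these relations is spanned by the multilinearity relations
  \<open>\<dots> \<otimes> (v + w) \<otimes> \<dots> - \<dots> \<otimes> v \<otimes> \<dots> - \<dots> \<otimes> w \<otimes> \<dots>\<close> and
  \<open>\<dots> \<otimes> c v \<otimes> \<dots> - c (\<dots> \<otimes> v \<otimes> \<dots>)\<close> on words of every fixed length, so the quotient is
  \<open>T(L) = \<Oplus>\<^sub>n L\<^sup>\<otimes>\<^sup>n\<close> with the concatenation product.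
\<close>

definition linearity_relations ::
  "('k::field \<Rightarrow> 'l::ab_group_add \<Rightarrow> 'l) \<Rightarrow> ('k, 'l) free_algebra set" where
  "linearity_relations scale =
     {free_gen (v + w) - free_gen v - free_gen w | v w. True} \<union>
     {free_gen (scale c v) - free_scalar c * free_gen v | c v. True}"

definition linearity_ideal ::
  "('k::field \<Rightarrow> 'l::ab_group_add \<Rightarrow> 'l) \<Rightarrow> ('k, 'l) free_algebra set" where
  "linearity_ideal scale = Idl\<^bsub>free_ring\<^esub> (linearity_relations scale)"

definition tensor_algebra ::
  "('k::field \<Rightarrow> 'l::ab_group_add \<Rightarrow> 'l) \<Rightarrow> ('k, 'l) free_algebra set ring" where
  "tensor_algebra scale = free_ring Quot linearity_ideal scale"

definition tensor_gen ::
  "('k::field \<Rightarrow> 'l::ab_group_add \<Rightarrow> 'l) \<Rightarrow> 'l \<Rightarrow> ('k, 'l) free_algebra set" where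
  "tensor_gen scale v = linearity_ideal scale +>\<^bsub>free_ring\<^esub> free_gen v"

definition tensor_scalar ::
  "('k::field \<Rightarrow> 'l::ab_group_add \<Rightarrow> 'l) \<Rightarrow> 'k \<Rightarrow> ('k, 'l) free_algebra set" where
  "tensor_scalar scale c = linearity_ideal scale +>\<^bsub>free_ring\<^esub> free_scalar c"

section \<open>The generalized enveloping algebra\<close>

text \<open>
  The generators are homogeneous for the \<open>G\<close>-grading of \<open>T(L)\<close> (as \<open>\<omega>\<close> vanishes on
  \<open>L g \<times> L h\<close> unless \<open>g + h = 0\<close>), so the two-sided ideal they generate is automatically graded.
\<close>

definition enveloping_relations ::
  "('k::field \<Rightarrow> 'l::ab_group_add \<Rightarrow> 'l) \<Rightarrow> ('g \<Rightarrow> 'l set) \<Rightarrow> ('g \<Rightarrow> 'g \<Rightarrow> 'k) \<Rightarrow>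
   ('l \<Rightarrow> 'l \<Rightarrow> 'l) \<Rightarrow> ('l \<Rightarrow> 'l \<Rightarrow> 'k) \<Rightarrow> ('k, 'l) free_algebra set set" where
  "enveloping_relations scale L \<epsilon> br \<omega> =
     (let T = tensor_algebra scale; t = tensor_gen scale; s = tensor_scalar scale in
      {t v\<^sub>1 \<otimes>\<^bsub>T\<^esub> t v\<^sub>2 \<ominus>\<^bsub>T\<^esub> s (\<epsilon> g h) \<otimes>\<^bsub>T\<^esub> (t v\<^sub>2 \<otimes>\<^bsub>T\<^esub> t v\<^sub>1) \<ominus>\<^bsub>T\<^esub> t (br v\<^sub>1 v\<^sub>2)
         \<ominus>\<^bsub>T\<^esub> s (\<omega> v\<^sub>1 v\<^sub>2) | g h v\<^sub>1 v\<^sub>2. v\<^sub>1 \<in> L g \<and> v\<^sub>2 \<in> L h})"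

definition enveloping_ideal ::
  "('k::field \<Rightarrow> 'l::ab_group_add \<Rightarrow> 'l) \<Rightarrow> ('g \<Rightarrow> 'l set) \<Rightarrow> ('g \<Rightarrow> 'g \<Rightarrow> 'k) \<Rightarrow>
   ('l \<Rightarrow> 'l \<Rightarrow> 'l) \<Rightarrow> ('l \<Rightarrow> 'l \<Rightarrow> 'k) \<Rightarrow> ('k, 'l) free_algebra set set" where
  "enveloping_ideal scale L \<epsilon> br \<omega> =
     Idl\<^bsub>tensor_algebra scale\<^esub> (enveloping_relations scale L \<epsilon> br \<omega>)"

definition canonical_image ::
  "('k::field \<Rightarrow> 'l::ab_group_add \<Rightarrow> 'l) \<Rightarrow> ('g \<Rightarrow> 'l set) \<Rightarrow> ('g \<Rightarrow> 'g \<Rightarrow> 'k) \<Rightarrow>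
   ('l \<Rightarrow> 'l \<Rightarrow> 'l) \<Rightarrow> ('l \<Rightarrow> 'l \<Rightarrow> 'k) \<Rightarrow> 'l \<Rightarrow> ('k, 'l) free_algebra set set" where
  "canonical_image scale L \<epsilon> br \<omega> v =
     enveloping_ideal scale L \<epsilon> br \<omega> +>\<^bsub>tensor_algebra scale\<^esub> tensor_gen scale v"

text \<open>A ring \<open>A\<close> with a map \<open>h\<close> from the scalars, viewed as a module via \<open>c \<odot> a = h c \<otimes> a\<close>.\<close>

definition ring_module :: "'a ring \<Rightarrow> ('k \<Rightarrow> 'a) \<Rightarrow> ('k, 'a) module" where
  "ring_module A h = \<lparr>carrier = carrier A, monoid.mult = monoid.mult A, one = one A, ring.zero = ring.zero A, ring.add = ring.add A,
     module.smult = (\<lambda>c a. h c \<otimes>\<^bsub>A\<^esub> a)\<rparr>"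

definition enveloping_algebra ::
  "('k::field \<Rightarrow> 'l::ab_group_add \<Rightarrow> 'l) \<Rightarrow> ('g \<Rightarrow> 'l set) \<Rightarrow> ('g \<Rightarrow> 'g \<Rightarrow> 'k) \<Rightarrow>
   ('l \<Rightarrow> 'l \<Rightarrow> 'l) \<Rightarrow> ('l \<Rightarrow> 'l \<Rightarrow> 'k) \<Rightarrow> ('k, ('k, 'l) free_algebra set set) module" where
  "enveloping_algebra scale L \<epsilon> br \<omega> =
     ring_module (tensor_algebra scale Quot enveloping_ideal scale L \<epsilon> br \<omega>)
       (\<lambda>c. enveloping_ideal scale L \<epsilon> br \<omega> +>\<^bsub>tensor_algebra scale\<^esub> tensor_scalar scale c)"

section \<open>Ordered monomials\<close>

definition ordered_indices ::
  "'i::linorder set \<Rightarrow> ('i \<Rightarrow> 'g) \<Rightarrow> ('g \<Rightarrow> 'g \<Rightarrow> 'k::field) \<Rightarrow> 'i list set" where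
  "ordered_indices I d \<epsilon> =
     {is. set is \<subseteq> I \<and>
        (\<forall>j. Suc j < length is \<longrightarrow>
           is ! j \<le> is ! Suc j \<and> (\<epsilon> (d (is ! j)) (d (is ! j)) \<noteq> 1 \<longrightarrow> is ! j < is ! Suc j))}"

definition monomial :: "('a, 'm) monoid_scheme \<Rightarrow> ('i \<Rightarrow> 'a) \<Rightarrow> 'i list \<Rightarrow> 'a" where
  "monomial U z is = foldr (\<lambda>i m. z i \<otimes>\<^bsub>U\<^esub> m) is \<one>\<^bsub>U\<^esub>"

section \<open>The enveloping algebra is a vector space\<close>

lemma ring_ring_of_type_algebra: "ring (ring_of_type_algebra :: 'a::ring_1 ring)"
proof -
  have "\<exists>y. x + y = 0" "\<exists>y. y + x = 0" for x :: 'a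
    by (rule exI[of _ "- x"], simp)+
  then show ?thesis
    unfolding ring_of_type_algebra_def
    by unfold_locales (auto simp: algebra_simps Units_def)
qed

lemma vectorspace_ring_module:
  assumes "field K" "ring A" "h \<in> ring_hom K A"
  shows "vectorspace K (ring_module A h)"
proof -
  interpret K: field K by fact
  interpret A: ring A by fact
  have [simp]: "carrier (ring_module A h) = carrier A" "ring.add (ring_module A h) = ring.add A"
    "ring.zero (ring_module A h) = ring.zero A"
    by (simp_all add: ring_module_def)
  have sm: "module.smult (ring_module A h) c a = h c \<otimes>\<^bsub>A\<^esub> a" for c a
    by (simp add: ring_module_def)
  have h: "c \<in> carrier K \<Longrightarrow> h c \<in> carrier A" for c
    using assms(3) by (rule ring_hom_closed)
  have ag: "abelian_group (ring_module A h)"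
    by (intro abelian_groupI) (auto simp: A.a_ac intro!: bexI[of _ "\<ominus>\<^bsub>A\<^esub> _"] A.l_neg)
  have "module K (ring_module A h)"
    by (intro moduleI ag K.cring_axioms)
      (use assms(3) in \<open>auto simp: sm h ring_hom_add ring_hom_mult ring_hom_one
        A.l_distr A.r_distr A.m_assoc\<close>)
  then show ?thesis
    using assms(1) by (simp add: vectorspace_def)
qed

lemma ring_tensor_algebra: "ring (tensor_algebra scale)"
  unfolding tensor_algebra_def linearity_ideal_def
  by (intro ideal.quotient_is_ring ring.genideal_ideal ring_ring_of_type_algebra)
    (simp add: ring_of_type_algebra_def)

lemma tensor_gen_closed: "tensor_gen scale v \<in> carrier (tensor_algebra scale)"
  by (auto simp: tensor_gen_def tensor_algebra_def FactRing_def A_RCOSETS_def'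
      ring_of_type_algebra_def)

lemma tensor_scalar_hom: "tensor_scalar scale \<in> ring_hom ring_of_type_algebra (tensor_algebra scale)"
proof -
  have "ideal (linearity_ideal scale) free_ring"
    unfolding linearity_ideal_def
    by (intro ring.genideal_ideal ring_ring_of_type_algebra) (simp add: ring_of_type_algebra_def)
  then have "(+>\<^bsub>free_ring\<^esub>) (linearity_ideal scale) \<in> ring_hom free_ring (tensor_algebra scale)"
    unfolding tensor_algebra_def by (rule ideal.rcos_ring_hom)
  moreover have "free_scalar \<in> ring_hom ring_of_type_algebra free_ring"
    by (auto intro!: ring_hom_memI
        simp: ring_of_type_algebra_def free_scalar_def single_add mult_single)
  ultimately have "(+>\<^bsub>free_ring\<^esub>) (linearity_ideal scale) \<circ> free_scalar
      \<in> ring_hom ring_of_type_algebra (tensor_algebra scale)"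
    by (rule ring_hom_trans[rotated])
  then show ?thesis
    by (simp add: tensor_scalar_def[abs_def] comp_def)
qed

lemma ideal_enveloping_ideal:
  "ideal (enveloping_ideal scale L \<epsilon> br \<omega>) (tensor_algebra scale)"
proof -
  interpret T: ring "tensor_algebra scale" by (rule ring_tensor_algebra)
  have "tensor_scalar scale c \<in> carrier (tensor_algebra scale)" for c
    using tensor_scalar_hom by (rule ring_hom_closed) (simp add: ring_of_type_algebra_def)
  then show ?thesis
    unfolding enveloping_ideal_def enveloping_relations_def Let_def
    by (intro T.genideal_ideal) (auto simp: tensor_gen_closed)
qed

lemma vectorspace_enveloping_algebra:
  fixes scale :: "'k::field \<Rightarrow> 'l::ab_group_add \<Rightarrow> 'l"
  shows "vectorspace ring_of_type_algebra (enveloping_algebra scale L \<epsilon> br \<omega>)"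
  unfolding enveloping_algebra_def
proof (rule vectorspace_ring_module)
  show "field (ring_of_type_algebra :: 'k ring)" by (rule field_from_type_algebra)
  show "ring (tensor_algebra scale Quot enveloping_ideal scale L \<epsilon> br \<omega>)"
    by (rule ideal.quotient_is_ring[OF ideal_enveloping_ideal])
  show "(\<lambda>c. enveloping_ideal scale L \<epsilon> br \<omega> +>\<^bsub>tensor_algebra scale\<^esub> tensor_scalar scale c)
      \<in> ring_hom ring_of_type_algebra (tensor_algebra scale Quot enveloping_ideal scale L \<epsilon> br \<omega>)"
    using ring_hom_trans[OF tensor_scalar_hom ideal.rcos_ring_hom[OF ideal_enveloping_ideal]]
    by (simp add: comp_def)
qed

end

theory Submission
  imports Defs
begin

text \<open>
  The proof is Bergman's diamond lemma, applied to the presentation of the enveloping algebra by the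
  basis \<open>x\<close>. In the free algebra on the index set, order words by length and then
  lexicographically. A pair \<open>i j\<close> with \<open>j < i\<close>, or with \<open>i = j\<close> of odd degree
  (\<open>\<epsilon> (d i) (d i) = -1\<close>), carries a defining relation \<open>red i j\<close> whose greatest word is \<open>i j\<close>
  with coefficient \<open>1\<close>. For \<open>i = j\<close> odd the relation reads
  \<open>2 x\<^sub>i x\<^sub>i = [x\<^sub>i, x\<^sub>i] + \<omega>(x\<^sub>i, x\<^sub>i)\<close>, so it has to be halved. The words
  without such a factor are exactly the ordered monomials, and rewriting along the well-founded order
  shows that they span (\<open>irreducible_normal_form\<close>).

  For independence, let \<open>f\<close> be a combination of irreducible words in the span of all
  \<open>u * red i j * v\<close>, with \<open>u\<close>, \<open>v\<close> words. Take the least word \<open>w\<close> such that \<open>f\<close> lies in the span of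
  those products with leading word at most \<open>w\<close>. Any two products with the same leading word \<open>w\<close>
  differ by a combination of products with smaller leading words (\<open>confluence\<close>); hence
  \<open>f = c e + (smaller)\<close> for one product \<open>e\<close>. A leading word is reducible, so \<open>w\<close> does not occur in
  \<open>f\<close> and \<open>c = 0\<close>, which contradicts the choice of \<open>w\<close> unless \<open>f = 0\<close>
  (\<open>red_span_irreducible_eq_zero\<close>).

  Confluence is formal when the two factors are disjoint. When they overlap in \<open>i j k\<close> it rests on a
  single identity (\<open>overlap_identity\<close>), valid for arbitrary homogeneous \<open>a\<close>, \<open>b\<close>, \<open>c\<close>: the six
  relations used to commute neighbours while reversing \<open>a b c\<close> add up to relations between an element and a
  bracket, which have length two. The Jacobi identity and the cocycle condition enter there. So does
  the degree condition on \<open>\<omega>\<close>: moving the scalar \<open>\<omega>(a, b)\<close> past \<open>c\<close> would otherwise cost the factor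
  \<open>\<epsilon>(g + h, k)\<close>. The repeated-index cases \<open>i = j\<close>, \<open>j = k\<close> and \<open>i = j = k\<close> are specialisations of
  the same identity, after division by \<open>2\<close> or \<open>6\<close>; this is where the characteristic matters.

  It remains to move between two presentations: \<open>U\<^sub>\<omega>(L)\<close> is built from the free algebra on the
  underlying set of \<open>L\<close> by two successive quotients, whereas the argument above takes place in the
  free algebra on the basis. Expansion in the basis (\<open>to_basis\<close>) and substitution of basis vectors
  (\<open>from_basis\<close>) are inverse to each other modulo the two ideals.
\<close>

section \<open>Free algebras\<close>

definition fscale :: "'k::field \<Rightarrow> ('k, 'a) free_algebra \<Rightarrow> ('k, 'a) free_algebra" where
  "fscale c f = free_scalar c * f"

definition wmon :: "'a list \<Rightarrow> ('k::field, 'a) free_algebra" where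
  "wmon w = Poly_Mapping.single (Word w) 1"

lemma lookup_fscale: "Poly_Mapping.lookup (fscale c f) w = c * Poly_Mapping.lookup f w"
  unfolding fscale_def free_scalar_def mult_map_scale_conv_mult[symmetric]
  by (simp add: Poly_Mapping.map.rep_eq when_def)

lemma lookup_wmon: "Poly_Mapping.lookup (wmon w) (Word v) = (if v = w then 1 else 0)"
  by (simp add: wmon_def lookup_single when_def)

lemma wmon_Nil: "wmon [] = 1"
  by (simp add: wmon_def flip: zero_word_def)

lemma wmon_append: "wmon (u @ v) = wmon u * wmon v"
  by (simp add: wmon_def mult_single)

lemma free_gen_eq_wmon: "free_gen a = wmon [a]"
  by (simp add: free_gen_def wmon_def)

lemma free_scalar_eq_fscale: "free_scalar c = fscale c 1"
  by (simp add: fscale_def)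

interpretation fa: vector_space "fscale :: 'k::field \<Rightarrow> ('k, 'a) free_algebra \<Rightarrow> _"
  by unfold_locales (auto intro!: poly_mapping_eqI simp: lookup_fscale lookup_add algebra_simps)

lemma sum_monomials:
  fixes f :: "('k::field, 'a) free_algebra"
  shows "f = (\<Sum>w\<in>Poly_Mapping.keys f. fscale (Poly_Mapping.lookup f w) (wmon (case w of Word v \<Rightarrow> v)))"
proof (rule poly_mapping_eqI)
  fix k :: "'a word"
  have "Poly_Mapping.lookup (\<Sum>w\<in>Poly_Mapping.keys f. fscale (Poly_Mapping.lookup f w) (wmon (case w of Word v \<Rightarrow> v))) k
    = (\<Sum>w\<in>Poly_Mapping.keys f. Poly_Mapping.lookup f w * (if k = w then 1 else 0))"
    unfolding lookup_sum by (cases k) (auto intro!: sum.cong simp: lookup_fscale lookup_wmon split: word.splits)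
  also have "\<dots> = (if k \<in> Poly_Mapping.keys f then Poly_Mapping.lookup f k else 0)"
    by (simp add: if_distrib[of "(*) _"] cong: if_cong)
  finally show "Poly_Mapping.lookup f k = Poly_Mapping.lookup (\<Sum>w\<in>Poly_Mapping.keys f. fscale (Poly_Mapping.lookup f w) (wmon (case w of Word v \<Rightarrow> v))) k"
    by (simp add: in_keys_iff)
qed

lemma span_wmon: "fa.span (range (wmon :: 'a list \<Rightarrow> ('k::field, 'a) free_algebra)) = UNIV"
proof -
  have "f \<in> fa.span (range wmon)" for f :: "('k, 'a) free_algebra"
    by (subst sum_monomials) (intro fa.span_sum fa.span_scale fa.span_base rangeI)
  then show ?thesis by auto
qed

lemma free_algebra_induct [case_names wmon add scale]:
  fixes f :: "('k::field, 'a) free_algebra"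
  assumes "\<And>w. P (wmon w)" "\<And>f g. P f \<Longrightarrow> P g \<Longrightarrow> P (f + g)" "\<And>c f. P f \<Longrightarrow> P (fscale c f)"
  shows "P f"
proof -
  have "f \<in> fa.span (range wmon)" by (simp add: span_wmon)
  then show ?thesis
  proof (induction rule: fa.span_induct_alt)
    case base
    show ?case using assms(3)[of "wmon []" 0] assms(1) by simp
  next
    case (step c x y)
    then show ?case using assms by auto
  qed
qed

lemma fscale_mult_left: "fscale c f * g = fscale c (f * g)"
  by (simp add: fscale_def mult.assoc)

text \<open>
  Scalars are central: they sit on the empty word, which commutes with every word.
\<close>

lemma fscale_mult_right:
  fixes f :: "('k::field, 'a) free_algebra"
  shows "f * fscale c g = fscale c (f * g)"
proof -
  have "wmon w * free_scalar c = free_scalar c * (wmon w :: ('k, 'a) free_algebra)" for w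
    by (simp add: wmon_def free_scalar_def mult_single)
  then have "f * free_scalar c = free_scalar c * f"
    by (induction f rule: free_algebra_induct)
      (simp_all add: distrib_left distrib_right fscale_def mult.assoc,
       simp add: free_scalar_def mult_single mult.commute flip: mult.assoc)
  then show ?thesis by (simp add: fscale_def flip: mult.assoc)
qed

text \<open>
  The universal property of the free algebra, for targets that are free algebras themselves.
\<close>

definition lift :: "('a \<Rightarrow> ('k::field, 'b) free_algebra) \<Rightarrow> ('k, 'a) free_algebra \<Rightarrow> ('k, 'b) free_algebra" where
  "lift \<phi> f = (\<Sum>w\<in>Poly_Mapping.keys f. fscale (Poly_Mapping.lookup f w) (prod_list (map \<phi> (case w of Word v \<Rightarrow> v))))"

lemma lift_superset:
  assumes "finite S" "Poly_Mapping.keys f \<subseteq> S"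
  shows "lift \<phi> f = (\<Sum>w\<in>S. fscale (Poly_Mapping.lookup f w) (prod_list (map \<phi> (case w of Word v \<Rightarrow> v))))"
  unfolding lift_def using assms
  by (intro sum.mono_neutral_left) (auto simp: in_keys_iff)

lemma lift_add: "lift \<phi> (f + g) = lift \<phi> f + lift \<phi> g"
proof -
  let ?S = "Poly_Mapping.keys f \<union> Poly_Mapping.keys g"
  have "Poly_Mapping.keys (f + g) \<subseteq> ?S" by (rule Poly_Mapping.keys_add)
  then show ?thesis
    by (simp add: lift_superset[of ?S] lookup_add fa.scale_left_distrib sum.distrib)
qed

lemma lift_fscale: "lift \<phi> (fscale c f) = fscale c (lift \<phi> f)"
proof -
  have "Poly_Mapping.keys (fscale c f) \<subseteq> Poly_Mapping.keys f" by (auto simp: in_keys_iff lookup_fscale)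
  then show ?thesis
    by (simp add: lift_superset[of "Poly_Mapping.keys f"] lookup_fscale fa.scale_sum_right)
qed

lemma lift_wmon: "lift \<phi> (wmon w) = prod_list (map \<phi> w)"
  by (simp add: lift_def wmon_def)

lemma lift_mult: "lift \<phi> (f * g) = lift \<phi> f * lift \<phi> g"
proof (induction f rule: free_algebra_induct)
  case (wmon u)
  show ?case
    by (induction g rule: free_algebra_induct)
      (simp_all add: lift_wmon lift_add lift_fscale distrib_left fscale_mult_right flip: wmon_append)
qed (simp_all add: distrib_right lift_add lift_fscale fscale_mult_left)

lemma lift_free_gen: "lift \<phi> (free_gen a) = \<phi> a"
  by (simp add: free_gen_eq_wmon lift_wmon)

lemma lift_one: "lift \<phi> 1 = 1"
  using lift_wmon[of \<phi> "[]"] by (simp add: wmon_Nil)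

lemma lift_zero: "lift \<phi> 0 = 0"
  by (simp add: lift_def)

lemma lift_uminus: "lift \<phi> (- f) = - lift \<phi> f"
  using lift_add[of \<phi> f "- f"] by (simp add: lift_zero eq_neg_iff_add_eq_0 add.commute)

lemma lift_diff: "lift \<phi> (f - g) = lift \<phi> f - lift \<phi> g"
  using lift_add[of \<phi> f "- g"] by (simp add: lift_uminus)

section \<open>The length-lexicographic order on words\<close>

definition word_less :: "'i::wellorder list \<Rightarrow> 'i list \<Rightarrow> bool" (infix "\<prec>" 50) where
  "v \<prec> w \<longleftrightarrow> (v, w) \<in> lenlex {(a, b). a < b}"

lemma trans_less: "trans {(a, b :: 'i::wellorder). a < b}"
  by (auto intro: transI)

lemma wf_word_less: "wf {(v, w :: 'i::wellorder list). v \<prec> w}"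
  unfolding word_less_def using wf_lenlex[OF wf] by simp

lemma word_less_trans: "u \<prec> v \<Longrightarrow> v \<prec> w \<Longrightarrow> u \<prec> w"
  unfolding word_less_def using lenlex_trans trans_less by blast

lemma word_less_irrefl: "\<not> w \<prec> w"
  unfolding word_less_def by (rule lenlex_irreflexive) simp

lemma word_less_linear: "u \<prec> v \<or> u = v \<or> v \<prec> u"
proof -
  have "total {(a, b :: 'a). a < b}" by (auto simp: total_on_def)
  from total_lenlex[OF this] show ?thesis by (auto simp: word_less_def total_on_def)
qed

lemma word_less_length: "length v < length w \<Longrightarrow> v \<prec> w"
  by (simp add: word_less_def lenlex_conv)

text \<open>
  Compatibility with concatenation on both sides is what makes a rewriting step inside a longer word
  decrease that word; the purely lexicographic order lacks it.
\<close>

lemma word_less_context: "v \<prec> w \<Longrightarrow> u @ v @ t \<prec> u @ w @ t"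
proof -
  assume "v \<prec> w"
  then have "v @ t \<prec> w @ t" unfolding word_less_def by (rule lenlex_append1) simp
  moreover have "irrefl {(a, b :: 'a). a < b}" by (auto simp: irrefl_def)
  ultimately show ?thesis unfolding word_less_def by simp
qed

section \<open>Commutation relations in the free algebra on a homogeneous basis\<close>

locale color_enveloping = color_lie_algebra scale L \<epsilon> br
  for scale :: "'k::field_char_0 \<Rightarrow> 'l::ab_group_add \<Rightarrow> 'l"
    and L :: "'g::ab_group_add \<Rightarrow> 'l set"
    and \<epsilon> :: "'g \<Rightarrow> 'g \<Rightarrow> 'k"
    and br :: "'l \<Rightarrow> 'l \<Rightarrow> 'l" +
  fixes \<omega> :: "'l \<Rightarrow> 'l \<Rightarrow> 'k"
    and I :: "'i::wellorder set"
    and x :: "'i \<Rightarrow> 'l"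
    and d :: "'i \<Rightarrow> 'g"
  assumes homogeneous_basis: "homogeneous_basis I x d"
    and cocycle: "\<omega> \<in> Z2_gr"
begin

lemma x_degree: "i \<in> I \<Longrightarrow> x i \<in> L (d i)"
  using homogeneous_basis by (simp add: homogeneous_basis_def)

lemma eps_inverse: "\<epsilon> g h * \<epsilon> h g = 1"
  and eps_add_left: "\<epsilon> (g + h) k = \<epsilon> g k * \<epsilon> h k"
  and eps_add_right: "\<epsilon> g (h + k) = \<epsilon> g h * \<epsilon> g k"
  and eps_nonzero: "\<epsilon> g h \<noteq> 0"
  using bicharacter by (simp_all add: antisymmetric_bicharacter_def)

lemma eps_zero_left: "\<epsilon> 0 g = 1" and eps_zero_right: "\<epsilon> g 0 = 1"
  using eps_add_left[of 0 0 g] eps_add_right[of g 0 0] eps_nonzero by auto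

lemma eps_self: "\<epsilon> g g \<noteq> 1 \<Longrightarrow> \<epsilon> g g = -1"
  using eps_inverse[of g g] by (metis square_eq_1_iff)

lemma br_add_left: "br (a + b) c = br a c + br b c"
  and br_scale_left: "br (scale r a) c = scale r (br a c)"
  and br_add_right: "br c (a + b) = br c a + br c b"
  and br_scale_right: "br c (scale r a) = scale r (br c a)"
  using br_linear_left[of c] br_linear_right[of c] by (simp_all add: Vector_Spaces.linear_iff)

lemma omega_add_left: "\<omega> (a + b) c = \<omega> a c + \<omega> b c"
  and omega_scale_left: "\<omega> (scale r a) c = r * \<omega> a c"
  and omega_add_right: "\<omega> c (a + b) = \<omega> c a + \<omega> c b"
  and omega_scale_right: "\<omega> c (scale r a) = r * \<omega> c a"
  using cocycle by (simp_all add: Z2_gr_def Vector_Spaces.linear_iff)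

lemma omega_degree: "a \<in> L g \<Longrightarrow> b \<in> L h \<Longrightarrow> \<omega> a b \<noteq> 0 \<Longrightarrow> g + h = 0"
  and omega_antisym: "a \<in> L g \<Longrightarrow> b \<in> L h \<Longrightarrow> \<omega> a b = - \<epsilon> g h * \<omega> b a"
  and omega_jacobi: "a \<in> L g \<Longrightarrow> b \<in> L h \<Longrightarrow> c \<in> L k \<Longrightarrow>
    \<epsilon> k g * \<omega> a (br b c) + \<epsilon> g h * \<omega> b (br c a) + \<epsilon> h k * \<omega> c (br a b) = 0"
  using cocycle unfolding Z2_gr_def by blast+

text \<open>
  Expansion of a vector in the basis \<open>x\<close>, each basis vector being read as a one-letter word.
\<close>

definition iota :: "'l \<Rightarrow> ('k, 'i) free_algebra" where
  "iota = vector_space_pair.construct scale fscale (x ` I) (\<lambda>b. free_gen (the_inv_into I x b))"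

lemma iota_add: "iota (a + b) = iota a + iota b"
  and iota_scale: "iota (scale r a) = fscale r (iota a)"
  and iota_x: "i \<in> I \<Longrightarrow> iota (x i) = wmon [i]"
proof -
  interpret vector_space_pair scale "fscale :: 'k \<Rightarrow> ('k, 'i) free_algebra \<Rightarrow> _"
    by unfold_locales
  have ind: "independent (x ` I)" and inj: "inj_on x I"
    using homogeneous_basis by (simp_all add: homogeneous_basis_def)
  have "Vector_Spaces.linear scale fscale iota"
    unfolding iota_def by (rule linear_construct[OF ind])
  then show "iota (a + b) = iota a + iota b" "iota (scale r a) = fscale r (iota a)"
    by (simp_all add: Vector_Spaces.linear_iff)
  show "iota (x i) = wmon [i]" if "i \<in> I"
    unfolding iota_def using that
    by (subst construct_basis[OF ind]) (simp_all add: the_inv_into_f_f[OF inj] free_gen_eq_wmon)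
qed

lemma iota_zero: "iota 0 = 0"
  using iota_add[of 0 0] by simp

lemma iota_uminus: "iota (- a) = - iota a"
  using iota_add[of a "- a"] by (simp add: iota_zero eq_neg_iff_add_eq_0 add.commute)

text \<open>
  Grouping an expansion in the basis by degrees yields homogeneous components; since the decomposition
  into components is unique, a vector of degree \<open>g\<close> has only terms of degree \<open>g\<close>.
\<close>

lemma component_subset_span: "a \<in> L g \<Longrightarrow> a \<in> span (x ` {i \<in> I. d i = g})"
proof -
  assume a: "a \<in> L g"
  let ?C = "\<lambda>h. span (x ` {i \<in> I. d i = h})"
  have C_L: "?C h \<subseteq> L h" for h
    by (intro span_minimal subspace_component) (auto dest: x_degree)
  have "a \<in> span (x ` I)"
    using homogeneous_basis by (simp add: homogeneous_basis_def)
  then have "\<exists>f S. finite S \<and> (\<forall>h. h \<notin> S \<longrightarrow> f h = 0) \<and> (\<forall>h. f h \<in> ?C h) \<and> a = (\<Sum>h\<in>S. f h)"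
  proof (induction rule: span_induct_alt)
    case base
    show ?case by (rule exI[of _ "\<lambda>_. 0"], rule exI[of _ "{}"]) (simp add: span_zero)
  next
    case (step c b a)
    then obtain f S i where f: "finite S" "\<And>h. h \<notin> S \<Longrightarrow> f h = 0" "\<And>h. f h \<in> ?C h" "a = (\<Sum>h\<in>S. f h)"
      and i: "i \<in> I" "b = x i" by auto
    let ?f = "\<lambda>h. (if h = d i then scale c b else 0) + f h"
    have "sum f (insert (d i) S) = sum f S"
      using f by (intro sum.mono_neutral_right) auto
    then have "scale c b + a = sum ?f (insert (d i) S)"
      using f(1,4) by (subst sum.distrib) (simp add: sum.delta)
    moreover have "?f h \<in> ?C h" for h
      using i f(3) by (auto intro!: span_add span_scale intro: span_base span_zero)
    ultimately show ?case
      using f(1,2) by (intro exI[of _ ?f] exI[of _ "insert (d i) S"]) auto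
  qed
  then obtain f S where f: "finite S" "\<And>h. h \<notin> S \<Longrightarrow> f h = 0" "\<And>h. f h \<in> ?C h" "a = (\<Sum>h\<in>S. f h)"
    by blast
  have fin: "finite {h. f h \<noteq> 0}" using f(1,2) by (metis (mono_tags) finite_subset mem_Collect_eq subsetI)
  have "(\<Sum>h\<in>S. f h) = (\<Sum>h | f h \<noteq> 0. f h)"
    using f(1,2) by (intro sum.mono_neutral_right) auto
  then have 1: "finite {h. f h \<noteq> 0} \<and> (\<forall>h. f h \<in> L h) \<and> a = (\<Sum>h | f h \<noteq> 0. f h)"
    using f C_L fin by auto
  \<comment> \<open>the trivial decomposition of the homogeneous vector \<open>a\<close>, to be compared with the one by degrees of basis vectors\<close>
  let ?f = "\<lambda>h. if h = g then a else 0"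
  have "{h. ?f h \<noteq> 0} = (if a = 0 then {} else {g})" by auto
  then have 2: "finite {h. ?f h \<noteq> 0} \<and> (\<forall>h. ?f h \<in> L h) \<and> a = (\<Sum>h | ?f h \<noteq> 0. ?f h)"
    using a subspace_0[OF subspace_component] by auto
  let ?P = "\<lambda>f :: 'g \<Rightarrow> 'l. finite {h. f h \<noteq> 0} \<and> (\<forall>h. f h \<in> L h) \<and> a = (\<Sum>h | f h \<noteq> 0. f h)"
  have "Uniq ?P" using direct_sum[of a] by (simp add: ex1_iff_ex_Uniq)
  from Uniq_D[OF this, of f ?f] 1 2 have "f = ?f" by blast
  then have "f g = a" by simp
  with f(3)[of g] show ?thesis by simp
qed

definition rel :: "'g \<Rightarrow> 'g \<Rightarrow> 'l \<Rightarrow> 'l \<Rightarrow> ('k, 'i) free_algebra" where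
  "rel g h a b = iota a * iota b - fscale (\<epsilon> g h) (iota b * iota a) - iota (br a b) - fscale (\<omega> a b) 1"

lemma rel_add_left: "rel g h (a + b) c = rel g h a c + rel g h b c"
  and rel_scale_left: "rel g h (scale r a) c = fscale r (rel g h a c)"
  and rel_add_right: "rel g h c (a + b) = rel g h c a + rel g h c b"
  and rel_scale_right: "rel g h c (scale r a) = fscale r (rel g h c a)"
  by (simp_all add: rel_def iota_add iota_scale br_add_left br_scale_left br_add_right br_scale_right
      omega_add_left omega_scale_left omega_add_right omega_scale_right distrib_left distrib_right
      fscale_mult_left fscale_mult_right fa.scale_right_diff_distrib fa.scale_right_distrib
      fa.scale_left_distrib mult.commute)

lemma rel_swap:
  assumes "a \<in> L g" "b \<in> L h"
  shows "rel g h a b = - fscale (\<epsilon> g h) (rel h g b a)"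
  unfolding rel_def br_antisym[OF assms] omega_antisym[OF assms]
  by (simp add: fa.scale_right_diff_distrib iota_uminus iota_scale eps_inverse)

text \<open>
  The Jacobi identity in the form ``\<open>br a\<close> is a colour derivation'', which avoids cyclic permutations
  of the arguments; \<open>omega_derivation\<close> does the same for the cocycle condition.
\<close>

lemma br_derivation:
  assumes "a \<in> L g" "b \<in> L h" "c \<in> L k"
  shows "br a (br b c) = br (br a b) c + scale (\<epsilon> g h) (br b (br a c))"
proof -
  \<comment> \<open>antisymmetry turns the cyclic terms into nested brackets of the required shape, with common factor \<open>\<epsilon> k g\<close>\<close>
  have ca: "br c a = scale (- \<epsilon> k g) (br a c)"
    using br_antisym[OF assms(3,1)] by simp
  have cab: "br c (br a b) = scale (- (\<epsilon> k g * \<epsilon> k h)) (br (br a b) c)"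
    using br_antisym[OF assms(3) br_graded[OF assms(1,2)]] by (simp add: eps_add_right)
  have e: "\<epsilon> h k * (\<epsilon> k g * \<epsilon> k h) = \<epsilon> k g"
    using eps_inverse[of h k] by (simp add: ac_simps)
  have "scale (\<epsilon> k g) (br a (br b c)) - scale (\<epsilon> k g) (scale (\<epsilon> g h) (br b (br a c)))
      - scale (\<epsilon> k g) (br (br a b) c) = 0"
    using br_jacobi[OF assms] unfolding ca cab br_scale_right
    by (simp add: e mult.commute[of "\<epsilon> g h" "\<epsilon> k g"])
  then have "scale (\<epsilon> k g) (br a (br b c)) = scale (\<epsilon> k g) (br (br a b) c + scale (\<epsilon> g h) (br b (br a c)))"
    by (simp add: scale_right_distrib algebra_simps)
  then show ?thesis by (simp add: eps_nonzero)
qed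

lemma omega_derivation:
  assumes "a \<in> L g" "b \<in> L h" "c \<in> L k"
  shows "\<omega> a (br b c) = \<omega> (br a b) c + \<epsilon> g h * \<omega> b (br a c)"
proof -
  have ca: "br c a = scale (- \<epsilon> k g) (br a c)"
    using br_antisym[OF assms(3,1)] by simp
  have cab: "\<omega> c (br a b) = (- (\<epsilon> k g * \<epsilon> k h)) * \<omega> (br a b) c"
    using omega_antisym[OF assms(3) br_graded[OF assms(1,2)]] by (simp add: eps_add_right)
  have e: "\<epsilon> h k * (\<epsilon> k g * \<epsilon> k h) = \<epsilon> k g"
    using eps_inverse[of h k] by (simp add: ac_simps)
  have "\<epsilon> h k * \<omega> c (br a b) = - (\<epsilon> k g * \<omega> (br a b) c)"
    using cab arg_cong[OF e, of "\<lambda>t. t * \<omega> (br a b) c"] by (simp add: mult.assoc)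
  then have "\<epsilon> k g * \<omega> a (br b c) - \<epsilon> k g * (\<epsilon> g h * \<omega> b (br a c)) - \<epsilon> k g * \<omega> (br a b) c = 0"
    using omega_jacobi[OF assms] unfolding ca omega_scale_right by (simp add: algebra_simps)
  then have "\<epsilon> k g * \<omega> a (br b c) = \<epsilon> k g * (\<omega> (br a b) c + \<epsilon> g h * \<omega> b (br a c))"
    by (simp add: algebra_simps)
  then show ?thesis by (simp add: eps_nonzero)
qed

text \<open>
  If \<open>\<omega> a b \<noteq> 0\<close> then the degrees of \<open>a\<close> and \<open>b\<close> cancel, so their commutation factors with any third
  degree \<open>k\<close> cancel as well.
\<close>

lemma omega_eps_invariant:
  assumes "a \<in> L g" "b \<in> L h"
  shows "\<omega> a b * (\<epsilon> g k * \<epsilon> h k) = \<omega> a b" "\<omega> a b * (\<epsilon> k g * \<epsilon> k h) = \<omega> a b"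
    "\<omega> a b * \<epsilon> g k = \<omega> a b * \<epsilon> k h"
proof -
  have *: "\<epsilon> g k * \<epsilon> h k = 1" "\<epsilon> k g * \<epsilon> k h = 1" if "g + h = 0"
    using that eps_add_left[of g h k] eps_add_right[of k g h] by (simp_all add: eps_zero_left eps_zero_right)
  have **: "\<epsilon> g k = \<epsilon> k h" if "g + h = 0"
    using *(1)[OF that] eps_inverse[of h k] by (metis mult.commute mult_right_cancel eps_nonzero)
  show "\<omega> a b * (\<epsilon> g k * \<epsilon> h k) = \<omega> a b" "\<omega> a b * (\<epsilon> k g * \<epsilon> k h) = \<omega> a b"
    "\<omega> a b * \<epsilon> g k = \<omega> a b * \<epsilon> k h"
    using omega_degree[OF assms] * ** by (cases "\<omega> a b = 0"; simp)+
qed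

text \<open>
  There are two ways to sort \<open>a b c\<close> into \<open>c b a\<close> by neighbour transpositions,
  \<open>abc, bac, bca, cba\<close> and \<open>abc, acb, cab, cba\<close>. The left-hand side is the difference of the two
  sums of relations used along the way, so all products of three generators cancel. What remains are
  products of a generator with a bracket, which the right-hand side rewrites as relations of length two,
  leaving the Jacobi identity and the cocycle condition, and products of a generator with a value of
  \<open>\<omega>\<close>, which cancel by \<open>omega_eps_invariant\<close>.
\<close>

lemma overlap_identity:
  assumes "a \<in> L g" "b \<in> L h" "c \<in> L k"
  shows "rel g h a b * iota c - iota a * rel h k b c
      + fscale (\<epsilon> g h) (iota b * rel g k a c) + fscale (\<epsilon> g h * \<epsilon> g k) (rel h k b c * iota a)
      - fscale (\<epsilon> h k) (rel g k a c * iota b) - fscale (\<epsilon> g k * \<epsilon> h k) (iota c * rel g h a b)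
    = rel g (h + k) a (br b c) - rel (g + h) k (br a b) c - fscale (\<epsilon> g h) (rel h (g + k) b (br a c))"
    (is "?lhs = ?rhs")
proof -
  have E: "\<epsilon> g h * \<epsilon> h (g + k) = \<epsilon> h k"
    using eps_inverse[of g h] by (simp add: eps_add_right flip: mult.assoc)
  have r3: "fscale (\<epsilon> g h) (rel h (g + k) b (br a c)) = fscale (\<epsilon> g h) (iota b * iota (br a c))
      - fscale (\<epsilon> h k) (iota (br a c) * iota b) - fscale (\<epsilon> g h) (iota (br b (br a c)))
      - fscale (\<epsilon> g h * \<omega> b (br a c)) 1"
    by (simp add: rel_def fa.scale_right_diff_distrib E)
  have "?lhs - ?rhs = fscale (\<omega> b c - \<omega> b c * (\<epsilon> g h * \<epsilon> g k)) (iota a)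
      + fscale (\<omega> a c * \<epsilon> h k - \<omega> a c * \<epsilon> g h) (iota b)
      + fscale (\<omega> a b * (\<epsilon> g k * \<epsilon> h k) - \<omega> a b) (iota c)
      + iota (br a (br b c)) - iota (br (br a b) c + scale (\<epsilon> g h) (br b (br a c)))
      + fscale (\<omega> a (br b c) - (\<omega> (br a b) c + \<epsilon> g h * \<omega> b (br a c))) 1"
    unfolding r3
    by (simp add: rel_def left_diff_distrib right_diff_distrib distrib_left distrib_right
        fscale_mult_left fscale_mult_right eps_add_left eps_add_right iota_add iota_scale
        fa.scale_right_diff_distrib fa.scale_left_diff_distrib fa.scale_left_distrib
        del: add_diff_eq diff_diff_eq2)
      (simp add: mult.assoc mult.commute mult.left_commute)
  also have "\<dots> = 0"
    by (simp add: omega_eps_invariant[OF assms(1,2)] omega_eps_invariant[OF assms(2,3)] omega_eps_invariant[OF assms(1,3), symmetric]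
        br_derivation[OF assms] omega_derivation[OF assms])
  finally show ?thesis by simp
qed

section \<open>Reductions and their confluence\<close>

definition reducible :: "'i \<Rightarrow> 'i \<Rightarrow> bool" where
  "reducible i j \<longleftrightarrow> i \<in> I \<and> j \<in> I \<and> (j < i \<or> i = j \<and> \<epsilon> (d i) (d i) \<noteq> 1)"

definition basis_rel :: "'i \<Rightarrow> 'i \<Rightarrow> ('k, 'i) free_algebra" where
  "basis_rel i j = rel (d i) (d j) (x i) (x j)"

text \<open>
  Normalised so that the word \<open>i j\<close> has coefficient \<open>1\<close>: for \<open>i = j\<close> of odd degree it occurs in
  \<open>basis_rel i i\<close> with coefficient \<open>1 - \<epsilon> (d i) (d i) = 2\<close>.
\<close>

definition red :: "'i \<Rightarrow> 'i \<Rightarrow> ('k, 'i) free_algebra" where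
  "red i j = (if i = j then fscale (1/2) (basis_rel i j) else basis_rel i j)"

text \<open>
  The predicate \<open>P\<close> restricts the leading words \<open>u @ [i, j] @ v\<close>. With \<open>P\<close> always true this is the
  two-sided ideal generated by the \<open>red i j\<close>; with \<open>P w = (w \<prec> v)\<close> it is the subspace in which
  ambiguities at \<open>v\<close> have to be resolved.
\<close>

definition red_span :: "('i list \<Rightarrow> bool) \<Rightarrow> ('k, 'i) free_algebra set" where
  "red_span P = fa.span {wmon u * red i j * wmon v | u i j v. reducible i j \<and> P (u @ [i, j] @ v)}"

lemma red_span_mono: "f \<in> red_span P \<Longrightarrow> (\<And>w. P w \<Longrightarrow> Q w) \<Longrightarrow> f \<in> red_span Q"
proof -
  assume "f \<in> red_span P" and PQ: "\<And>w. P w \<Longrightarrow> Q w"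
  moreover have "red_span P \<subseteq> red_span Q" unfolding red_span_def using PQ by (intro fa.span_mono) blast
  ultimately show ?thesis by blast
qed

lemma red_in_red_span: "reducible i j \<Longrightarrow> P (u @ [i, j] @ v) \<Longrightarrow> wmon u * red i j * wmon v \<in> red_span P"
  unfolding red_span_def by (rule fa.span_base) blast

lemma red_span_add: "f \<in> red_span P \<Longrightarrow> g \<in> red_span P \<Longrightarrow> f + g \<in> red_span P"
  and red_span_diff: "f \<in> red_span P \<Longrightarrow> g \<in> red_span P \<Longrightarrow> f - g \<in> red_span P"
  and red_span_scale: "f \<in> red_span P \<Longrightarrow> fscale c f \<in> red_span P"
  and red_span_zero: "0 \<in> red_span P"
  unfolding red_span_def by (rule fa.span_add fa.span_diff fa.span_scale fa.span_zero; assumption)+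

lemma red_span_context:
  assumes "f \<in> red_span (\<lambda>w. P (u @ w @ v))"
  shows "wmon u * f * wmon v \<in> red_span P"
  using assms unfolding red_span_def
proof (induction rule: fa.span_induct_alt)
  case base
  show ?case by (simp add: fa.span_zero)
next
  case (step c f g)
  then obtain u' i j v' where f: "f = wmon u' * red i j * wmon v'" and b: "reducible i j" "P (u @ (u' @ [i, j] @ v') @ v)"
    by blast
  have "wmon u * f * wmon v = wmon (u @ u') * red i j * wmon (v' @ v)"
    by (simp add: f wmon_append mult.assoc)
  also have "\<dots> \<in> red_span P" using b by (intro red_in_red_span) simp_all
  finally have "wmon u * f * wmon v \<in> red_span P" .
  with step show ?case
    unfolding red_span_def by (simp add: distrib_left distrib_right fscale_mult_left fscale_mult_right fa.span_add fa.span_scale)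
qed

lemma red_span_context_left: "f \<in> red_span (\<lambda>w. P (u @ w)) \<Longrightarrow> wmon u * f \<in> red_span P"
  using red_span_context[of f P u "[]"] by (simp add: wmon_Nil)

lemma red_span_context_right: "f \<in> red_span (\<lambda>w. P (w @ v)) \<Longrightarrow> f * wmon v \<in> red_span P"
  using red_span_context[of f P "[]" v] by (simp add: wmon_Nil)

lemma reducible_self: "reducible i i \<Longrightarrow> \<epsilon> (d i) (d i) = -1"
  by (simp add: reducible_def eps_self)

lemma basis_rel_eq_red: "basis_rel i j = (if i = j then fscale 2 (red i j) else red i j)"
  by (simp add: red_def)

lemma basis_rel_le_in_red_span:
  assumes "i \<in> I" "j \<in> I" "j \<le> i" "P [i, j]"
  shows "basis_rel i j \<in> red_span P"
proof (cases "reducible i j")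
  case True
  then have "red i j \<in> red_span P"
    using red_in_red_span[of i j P "[]" "[]"] assms(4) by (simp add: wmon_Nil)
  then show ?thesis by (auto simp: basis_rel_eq_red intro: red_span_scale)
next
  case False
  with assms have *: "i = j" "\<epsilon> (d i) (d i) = 1" by (auto simp: reducible_def)
  have xi: "x i \<in> L (d i)" using assms by (simp add: x_degree)
  \<comment> \<open>a vector of even degree has vanishing bracket and cocycle with itself, so the relation is trivial\<close>
  have double: "a = 0" if "a = - a" for a :: 'l
  proof -
    from that have "scale 2 a = 0" by (metis add.right_inverse one_add_one scale_left_distrib scale_one)
    then show ?thesis by simp
  qed
  have "br (x i) (x i) = 0"
    using br_antisym[OF xi xi] * by (intro double) simp
  moreover have "\<omega> (x i) (x i) = 0"
    using omega_antisym[OF xi xi] * by simp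
  ultimately have "basis_rel i j = 0"
    using * by (simp add: basis_rel_def rel_def iota_zero)
  then show ?thesis by (simp add: red_span_zero)
qed

lemma basis_rel_in_red_span:
  assumes "i \<in> I" "j \<in> I" "P [i, j]" "P [j, i]"
  shows "basis_rel i j \<in> red_span P"
proof (cases "j \<le> i")
  case True
  with assms show ?thesis by (simp add: basis_rel_le_in_red_span)
next
  case False
  have "basis_rel i j = fscale (- \<epsilon> (d i) (d j)) (basis_rel j i)"
    using rel_swap[OF x_degree x_degree, of i j] assms by (simp add: basis_rel_def)
  moreover have "basis_rel j i \<in> red_span P"
    using False assms by (simp add: basis_rel_le_in_red_span)
  ultimately show ?thesis by (simp only: red_span_scale)
qed

text \<open>
  By bilinearity only relations between basis vectors matter. This handles relations that involve
  a bracket, which is a combination of unknown basis vectors; the hypothesis therefore speaks about all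
  two-letter words.
\<close>

lemma rel_in_red_span:
  assumes "a \<in> L g" "b \<in> L h" "\<And>i j. P [i, j]"
  shows "rel g h a b \<in> red_span P"
proof -
  have 1: "rel g h (x i) b \<in> red_span P" if "i \<in> I" "d i = g" for i
    using component_subset_span[OF assms(2)]
  proof (induction rule: span_induct_alt)
    case base
    show ?case using rel_scale_right[of g h "x i" 0 0] by (simp add: red_span_zero)
  next
    case (step c y z)
    then obtain j where "j \<in> I" "d j = h" "y = x j" by blast
    with that basis_rel_in_red_span[of i j P] have "rel g h (x i) y \<in> red_span P"
      by (simp add: assms(3) basis_rel_def)
    with step show ?case by (simp add: rel_add_right rel_scale_right red_span_add red_span_scale)
  qed
  show ?thesis
    using component_subset_span[OF assms(1)]
  proof (induction rule: span_induct_alt)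
    case base
    show ?case using rel_scale_left[of g h 0 0 b] by (simp add: red_span_zero)
  next
    case (step c y z)
    with 1 show ?case by (auto simp: rel_add_left rel_scale_left intro!: red_span_add red_span_scale)
  qed
qed

text \<open>
  The right-hand side of \<open>overlap_identity\<close> is a combination of relations of length two, whose leading
  words are below any word of length three.
\<close>

lemma overlap_relation:
  assumes "i \<in> I" "j \<in> I" "k \<in> I"
  defines "e1 \<equiv> \<epsilon> (d i) (d j)" and "e2 \<equiv> \<epsilon> (d i) (d k)" and "e3 \<equiv> \<epsilon> (d j) (d k)"
  shows "basis_rel i j * wmon [k] - wmon [i] * basis_rel j k
      + fscale e1 (wmon [j] * basis_rel i k) + fscale (e1 * e2) (basis_rel j k * wmon [i])
      - fscale e3 (basis_rel i k * wmon [j]) - fscale (e2 * e3) (wmon [k] * basis_rel i j)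
    \<in> red_span (\<lambda>w. w \<prec> [i, j, k])"
proof -
  note X = assms(1-3)[THEN x_degree]
  show ?thesis
    unfolding basis_rel_def e1_def e2_def e3_def assms(1-3)[THEN iota_x, symmetric]
      overlap_identity[OF X]
    by (intro red_span_diff red_span_scale rel_in_red_span br_graded X word_less_length) simp_all
qed

text \<open>
  In each case the terms of \<open>overlap_relation\<close> with leading word below \<open>i j k\<close> are discarded. Those
  with leading word \<open>i j k\<close> combine to the multiple of the wanted difference given by the number of
  arrangements of \<open>i\<close>, \<open>j\<close>, \<open>k\<close> that fix the word: \<open>1\<close>, \<open>2\<close> or \<open>6\<close>.
\<close>

lemma overlap_resolves:
  assumes ij: "reducible i j" and jk: "reducible j k"
  shows "red i j * wmon [k] - wmon [i] * red j k \<in> red_span (\<lambda>w. w \<prec> [i, j, k])"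
    (is "?f \<in> ?J")
proof -
  have I: "i \<in> I" "j \<in> I" "k \<in> I" and ord: "j \<le> i" "k \<le> j"
    using ij jk by (auto simp: reducible_def)
  let ?e1 = "\<epsilon> (d i) (d j)" and ?e2 = "\<epsilon> (d i) (d k)" and ?e3 = "\<epsilon> (d j) (d k)"
  note rels = overlap_relation[OF I]
  have L: "wmon [a] * basis_rel b c \<in> ?J" if "b \<in> I" "c \<in> I" "c \<le> b" "[a, b, c] \<prec> [i, j, k]" for a b c
    using that by (intro red_span_context_left basis_rel_le_in_red_span) simp_all
  have R: "basis_rel a b * wmon [c] \<in> ?J" if "a \<in> I" "b \<in> I" "b \<le> a" "[a, b, c] \<prec> [i, j, k]" for a b c
    using that by (intro red_span_context_right basis_rel_le_in_red_span) simp_all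
  have less: "[a, b, c] \<prec> [i, j, k] \<longleftrightarrow> a < i \<or> a = i \<and> (b < j \<or> b = j \<and> c < k)" for a b c
    by (simp add: word_less_def Cons_lenlex_iff)
  have two: "fscale 2 v = v + v" for v :: "('k, 'i) free_algebra"
    using fa.scale_left_distrib[of 1 1 v] by simp
  show ?thesis
  proof (cases "i = j"; cases "j = k")
    assume eq: "i = j" "j = k"
    with ij have e: "\<epsilon> (d i) (d i) = -1" by (simp add: reducible_self)
    have six: "fscale 6 v = fscale 2 v + fscale 2 v + fscale 2 v" for v :: "('k, 'i) free_algebra"
      by (simp flip: fa.scale_left_distrib)
    \<comment> \<open>with all indices equal and odd, the six terms pair up to three copies of the commutator of \<open>basis_rel i i = 2 red i i\<close> with \<open>i\<close>\<close>
    have "fscale 6 ?f \<in> ?J"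
      using rels unfolding eq[symmetric] e basis_rel_eq_red six
      by (simp add: fscale_mult_left fscale_mult_right fa.scale_right_diff_distrib algebra_simps)
    then have "fscale (1/6) (fscale 6 ?f) \<in> ?J" by (rule red_span_scale)
    then show ?thesis by simp
  next
    assume eq: "i = j" "j \<noteq> k"
    with ord have "k < i" by simp
    with ij eq have e: "\<epsilon> (d i) (d i) = -1" by (simp add: reducible_self)
    have "basis_rel i k * wmon [i] \<in> ?J" "wmon [k] * basis_rel i i \<in> ?J"
      by (rule R L; use \<open>k < i\<close> I eq(1) in \<open>simp add: word_less_def Cons_lenlex_iff\<close>)+
    then have "fscale ?e2 (basis_rel i k * wmon [i]) + fscale ?e2 (basis_rel i k * wmon [i])
        + fscale (?e2 * ?e2) (wmon [k] * basis_rel i i) \<in> ?J"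
      by (intro red_span_add red_span_scale)
    from red_span_add[OF rels this] eq e have "fscale 2 ?f \<in> ?J"
      by (simp add: basis_rel_eq_red fscale_mult_left fscale_mult_right two algebra_simps)
    then have "fscale (1/2) (fscale 2 ?f) \<in> ?J" by (rule red_span_scale)
    then show ?thesis by simp
  next
    assume eq: "i \<noteq> j" "j = k"
    with ord have "j < i" by simp
    with jk eq have e: "\<epsilon> (d j) (d j) = -1" by (simp add: reducible_self)
    have "wmon [j] * basis_rel i j \<in> ?J" "basis_rel j j * wmon [i] \<in> ?J"
      by (rule L R; use \<open>j < i\<close> I eq(2) in \<open>simp add: word_less_def Cons_lenlex_iff\<close>)+
    then have "fscale ?e1 (wmon [j] * basis_rel i j) + fscale ?e1 (wmon [j] * basis_rel i j)
        + fscale (?e1 * ?e1) (basis_rel j j * wmon [i]) \<in> ?J"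
      by (intro red_span_add red_span_scale)
    from red_span_diff[OF rels this] eq e have "fscale 2 ?f \<in> ?J"
      by (simp add: basis_rel_eq_red fscale_mult_left fscale_mult_right two algebra_simps)
    then have "fscale (1/2) (fscale 2 ?f) \<in> ?J" by (rule red_span_scale)
    then show ?thesis by simp
  next
    assume neq: "i \<noteq> j" "j \<noteq> k"
    with ord have "j < i" "k < j" "k < i" "i \<noteq> k" by auto
    then have "wmon [j] * basis_rel i k \<in> ?J" "basis_rel j k * wmon [i] \<in> ?J"
      "basis_rel i k * wmon [j] \<in> ?J" "wmon [k] * basis_rel i j \<in> ?J"
      using I by (auto intro!: L R simp: less)
    then have "fscale ?e1 (wmon [j] * basis_rel i k) + fscale (?e1 * ?e2) (basis_rel j k * wmon [i])
        - fscale ?e3 (basis_rel i k * wmon [j]) - fscale (?e2 * ?e3) (wmon [k] * basis_rel i j) \<in> ?J"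
      by (intro red_span_add red_span_diff red_span_scale)
    from red_span_diff[OF rels this] show ?thesis
      using neq by (simp add: red_def algebra_simps)
  qed
qed

text \<open>
  The condition on letters ensures that rewriting a word over \<open>I\<close> never introduces letters
  outside \<open>I\<close>.
\<close>

definition below :: "'i list \<Rightarrow> ('k, 'i) free_algebra set" where
  "below w = fa.span {wmon t | t. t \<prec> w \<and> set t \<subseteq> set w \<union> I}"

lemma below_add: "f \<in> below w \<Longrightarrow> g \<in> below w \<Longrightarrow> f + g \<in> below w"
  and below_diff: "f \<in> below w \<Longrightarrow> g \<in> below w \<Longrightarrow> f - g \<in> below w"
  and below_scale: "f \<in> below w \<Longrightarrow> fscale c f \<in> below w"
  and below_zero: "0 \<in> below w"
  unfolding below_def by (rule fa.span_add fa.span_diff fa.span_scale fa.span_zero; assumption)+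

lemma wmon_in_below: "t \<prec> w \<Longrightarrow> set t \<subseteq> set w \<union> I \<Longrightarrow> wmon t \<in> below w"
  unfolding below_def by (rule fa.span_base) blast

lemma iota_in_below:
  assumes "length w \<ge> 2"
  shows "iota a \<in> below w"
proof -
  have "a \<in> span (x ` I)"
    using homogeneous_basis by (simp add: homogeneous_basis_def)
  then show ?thesis
  proof (induction rule: span_induct_alt)
    case base
    show ?case by (simp add: iota_zero below_zero)
  next
    case (step c y z)
    then have "iota y \<in> below w"
      using assms by (auto simp: iota_x intro!: wmon_in_below word_less_length)
    with step show ?case by (simp add: iota_add iota_scale below_add below_scale)
  qed
qed

lemma red_leading:
  assumes "reducible i j"
  shows "red i j - wmon [i, j] \<in> below [i, j]"
proof -
  have I: "i \<in> I" "j \<in> I" using assms by (auto simp: reducible_def)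
  \<comment> \<open>the part of the relation of length at most one\<close>
  let ?t = "iota (br (x i) (x j)) + fscale (\<omega> (x i) (x j)) (wmon [])"
  have t: "?t \<in> below [i, j]"
    by (intro below_add below_scale iota_in_below wmon_in_below word_less_length) simp_all
  have rel: "basis_rel i j = wmon [i, j] - fscale (\<epsilon> (d i) (d j)) (wmon [j, i]) - ?t"
    using I by (simp add: basis_rel_def rel_def iota_x wmon_Nil algebra_simps flip: wmon_append)
  show ?thesis
  proof (cases "i = j")
    case True
    then have "\<epsilon> (d i) (d j) = -1" using assms by (simp add: reducible_self)
    then have "red i j - wmon [i, j] = fscale (- (1/2)) ?t"
      using True unfolding red_def rel
      by (simp add: fa.scale_right_diff_distrib fa.scale_right_distrib flip: fa.scale_left_distrib)
    with below_scale[OF t] show ?thesis by (simp only:)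
  next
    case False
    with assms have "wmon [j, i] \<in> below [i, j]"
      by (intro wmon_in_below) (auto simp: reducible_def word_less_def Cons_lenlex_iff)
    then have "fscale (- \<epsilon> (d i) (d j)) (wmon [j, i]) - ?t \<in> below [i, j]"
      using t by (intro below_diff below_scale)
    with False show ?thesis by (simp add: red_def rel)
  qed
qed

lemma below_context:
  assumes "f \<in> below w"
  shows "wmon u * f * wmon v \<in> below (u @ w @ v)"
  using assms unfolding below_def[of w]
proof (induction rule: fa.span_induct_alt)
  case base
  show ?case by (simp add: below_zero)
next
  case (step c f g)
  then obtain t where t: "f = wmon t" "t \<prec> w" "set t \<subseteq> set w \<union> I" by blast
  have "wmon u * f * wmon v = wmon (u @ t @ v)" by (simp add: t wmon_append mult.assoc)
  also have "\<dots> \<in> below (u @ w @ v)"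
    using t by (intro wmon_in_below word_less_context) auto
  finally show ?case
    using step by (simp add: distrib_left distrib_right fscale_mult_left fscale_mult_right below_add below_scale)
qed

text \<open>
  Each of the two products arises from \<open>red i j * m * red k l\<close> by replacing one relation by its
  leading word. This changes the factor by an element of \<open>below\<close>, and multiplying that element by the
  other relation leaves only smaller leading words.
\<close>

lemma disjoint_resolves:
  assumes "reducible i j" "reducible k l"
  shows "red i j * wmon (m @ [k, l]) - wmon ([i, j] @ m) * red k l \<in> red_span (\<lambda>w. w \<prec> [i, j] @ m @ [k, l])"
    (is "_ \<in> ?J")
proof -
  have L: "f * wmon m * red k l \<in> ?J" if "f \<in> below [i, j]" for f
    using that unfolding below_def
  proof (induction rule: fa.span_induct_alt)
    case base
    show ?case by (simp add: red_span_zero)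
  next
    case (step c f g)
    then obtain t where t: "f = wmon t" "t \<prec> [i, j]" by blast
    have "(t @ m) @ [k, l] @ [] \<prec> [i, j] @ m @ [k, l]"
      using word_less_context[OF t(2), of "[]" "m @ [k, l]"] by simp
    with red_in_red_span[OF assms(2), of "\<lambda>w. w \<prec> [i, j] @ m @ [k, l]" "t @ m" "[]"] have "f * wmon m * red k l \<in> ?J"
      by (simp add: t wmon_append wmon_Nil)
    with step show ?case by (simp add: distrib_right fscale_mult_left red_span_add red_span_scale)
  qed
  have R: "red i j * wmon m * f \<in> ?J" if "f \<in> below [k, l]" for f
    using that unfolding below_def
  proof (induction rule: fa.span_induct_alt)
    case base
    show ?case by (simp add: red_span_zero)
  next
    case (step c f g)
    then obtain t where t: "f = wmon t" "t \<prec> [k, l]" by blast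
    have "[] @ [i, j] @ m @ t \<prec> [i, j] @ m @ [k, l]"
      using word_less_context[OF t(2), of "[i, j] @ m" "[]"] by simp
    with red_in_red_span[OF assms(1), of "\<lambda>w. w \<prec> [i, j] @ m @ [k, l]" "[]" "m @ t"] have "red i j * wmon m * f \<in> ?J"
      by (simp add: t wmon_append wmon_Nil mult.assoc)
    with step show ?case by (simp add: distrib_left fscale_mult_right red_span_add red_span_scale)
  qed
  have "red i j * wmon (m @ [k, l]) - wmon ([i, j] @ m) * red k l
      = (red i j - wmon [i, j]) * wmon m * red k l - red i j * wmon m * (red k l - wmon [k, l])"
    unfolding wmon_append by (simp add: algebra_simps)
  also have "\<dots> \<in> ?J"
    using assms by (intro red_span_diff L R red_leading)
  finally show ?thesis .
qed

lemma confluence_right: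
  assumes "reducible i j" "reducible k l" "[i, j] @ v = m @ [k, l] @ v'"
  shows "wmon u * red i j * wmon v - wmon (u @ m) * red k l * wmon v' \<in> red_span (\<lambda>t. t \<prec> u @ [i, j] @ v)"
    (is "_ \<in> ?J")
proof -
  consider "m = []" "i = k" "j = l" "v = v'" | "m = [i]" "j = k" "v = [l] @ v'"
    | m' where "m = [i, j] @ m'" "v = m' @ [k, l] @ v'"
    using assms(3) by (cases m; cases "tl m") auto
  then show ?thesis
  proof cases
    case 1
    then show ?thesis by (simp add: red_span_zero)
  next
    case 2
    have "red i j * wmon [l] - wmon [i] * red k l \<in> red_span (\<lambda>t. u @ t @ v' \<prec> u @ [i, j] @ v)"
      using overlap_resolves[of i j l] assms(1,2) 2
      by (auto elim!: red_span_mono dest: word_less_context[of _ _ u v'])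
    from red_span_context[OF this] show ?thesis
      unfolding 2 wmon_append by (simp add: algebra_simps)
  next
    case 3
    have "red i j * wmon (m' @ [k, l]) - wmon ([i, j] @ m') * red k l \<in> red_span (\<lambda>t. u @ t @ v' \<prec> u @ [i, j] @ v)"
      using disjoint_resolves[OF assms(1,2), of m'] 3
      by (auto elim!: red_span_mono dest: word_less_context[of _ _ u v'])
    from red_span_context[OF this] show ?thesis
      unfolding 3 wmon_append by (simp add: algebra_simps)
  qed
qed

lemma confluence:
  assumes "reducible i j" "reducible k l" "u @ [i, j] @ v = u' @ [k, l] @ v'"
  shows "wmon u * red i j * wmon v - wmon u' * red k l * wmon v' \<in> red_span (\<lambda>t. t \<prec> u @ [i, j] @ v)"
    (is "?f \<in> ?J")
proof -
  from assms(3) consider m where "u' = u @ m" "[i, j] @ v = m @ [k, l] @ v'"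
    | m where "u = u' @ m" "[k, l] @ v' = m @ [i, j] @ v"
    unfolding append_eq_append_conv2 by metis
  then show ?thesis
  proof cases
    case 1
    then show ?thesis using confluence_right[OF assms(1,2)] by simp
  next
    case 2
    then have "- ?f \<in> ?J" using confluence_right[OF assms(2,1) 2(2), of u'] assms(3) by simp
    then show ?thesis using red_span_diff[OF red_span_zero, of "- ?f"] by simp
  qed
qed

section \<open>Irreducible words\<close>

text \<open>
  Letters outside \<open>I\<close> are never reducible, so words containing them may count as irreducible; only
  words over \<open>I\<close> correspond to monomials.
\<close>

definition irreducible_word :: "'i list \<Rightarrow> bool" where
  "irreducible_word w \<longleftrightarrow> (\<nexists>u i j v. reducible i j \<and> w = u @ [i, j] @ v)"

lemma leading_in_below:
  assumes "reducible i j"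
  shows "wmon u * red i j * wmon v - wmon (u @ [i, j] @ v) \<in> below (u @ [i, j] @ v)"
proof -
  have "wmon u * red i j * wmon v - wmon (u @ [i, j] @ v) = wmon u * (red i j - wmon [i, j]) * wmon v"
    unfolding wmon_append by (simp add: algebra_simps)
  then show ?thesis using below_context[OF red_leading[OF assms]] by simp
qed

lemma coeff_below: "f \<in> below w \<Longrightarrow> Poly_Mapping.lookup f (Word w) = 0"
  unfolding below_def
  by (induction rule: fa.span_induct_alt)
    (auto simp: lookup_add lookup_fscale lookup_wmon word_less_irrefl split: if_splits)

lemma coeff_leading:
  "reducible i j \<Longrightarrow> Poly_Mapping.lookup (wmon u * red i j * wmon v) (Word (u @ [i, j] @ v)) = 1"
  using coeff_below[OF leading_in_below[of i j u v]] by (simp add: lookup_minus lookup_wmon)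

lemma coeff_red_span_less: "f \<in> red_span (\<lambda>t. t \<prec> w) \<Longrightarrow> Poly_Mapping.lookup f (Word w) = 0"
  unfolding red_span_def
proof (induction rule: fa.span_induct_alt)
  case (step c f g)
  then obtain u i j v where f: "f = wmon u * red i j * wmon v" "reducible i j" and less: "u @ [i, j] @ v \<prec> w"
    by blast
  let ?t = "u @ [i, j] @ v"
  have "Poly_Mapping.lookup g (Word w) = 0" if "g \<in> below ?t" for g
    using that unfolding below_def
    by (induction rule: fa.span_induct_alt)
      (use less in \<open>auto simp: lookup_add lookup_fscale lookup_wmon word_less_irrefl dest: word_less_trans split: if_splits\<close>)
  from this[OF leading_in_below[OF f(2)]] less have "Poly_Mapping.lookup f (Word w) = 0"
    by (auto simp: f(1) lookup_minus lookup_wmon word_less_irrefl)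
  with step show ?case by (simp add: lookup_add lookup_fscale)
qed simp

text \<open>
  An element of the span uses finitely many products, and the order is total, so there is a greatest
  leading word among them.
\<close>

lemma red_span_bounded:
  assumes "f \<in> red_span P"
  shows "f = 0 \<or> (\<exists>w. P w \<and> f \<in> red_span (\<lambda>t. t \<prec> w \<or> t = w))"
  using assms unfolding red_span_def[of P]
proof (induction rule: fa.span_induct_alt)
  case (step c f g)
  then obtain u i j v where f: "f = wmon u * red i j * wmon v" "reducible i j" and P: "P (u @ [i, j] @ v)"
    by blast
  let ?t = "u @ [i, j] @ v"
  have cf_le: "fscale c f \<in> red_span (\<lambda>t. t \<prec> w \<or> t = w)" if "?t \<prec> w \<or> ?t = w" for w
    unfolding f(1) using f(2) that by (intro red_span_scale red_in_red_span)
  show ?case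
  proof (cases "g = 0")
    case True
    with cf_le[of ?t] P show ?thesis by auto
  next
    case False
    with step obtain w where w: "P w" "g \<in> red_span (\<lambda>t. t \<prec> w \<or> t = w)" by blast
    show ?thesis
    proof (cases "w \<prec> ?t")
      case True
      then have "g \<in> red_span (\<lambda>t. t \<prec> ?t \<or> t = ?t)"
        by (intro red_span_mono[OF w(2)]) (auto dest: word_less_trans)
      then show ?thesis using cf_le[of ?t] P by (blast intro: red_span_add)
    next
      case False
      then show ?thesis using cf_le[of w] w word_less_linear[of w ?t] by (blast intro: red_span_add)
    qed
  qed
qed simp

text \<open>
  By confluence all products with leading word \<open>w\<close> agree modulo smaller ones, so one of them suffices
  to represent the top part.
\<close>

lemma red_span_leading_decomposition:
  assumes e: "reducible i j" "w = u @ [i, j] @ v" and f: "f \<in> red_span (\<lambda>t. t \<prec> w \<or> t = w)"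
  shows "\<exists>c. f - fscale c (wmon u * red i j * wmon v) \<in> red_span (\<lambda>t. t \<prec> w)"
  using f unfolding red_span_def[of "\<lambda>t. t \<prec> w \<or> t = w"]
proof (induction rule: fa.span_induct_alt)
  case base
  show ?case by (rule exI[of _ 0]) (simp add: red_span_zero)
next
  case (step c f g)
  let ?e = "wmon u * red i j * wmon v"
  from step obtain c' where c': "g - fscale c' ?e \<in> red_span (\<lambda>t. t \<prec> w)" by blast
  from step obtain u' k l v' where f: "f = wmon u' * red k l * wmon v'" "reducible k l"
    and t: "u' @ [k, l] @ v' \<prec> w \<or> u' @ [k, l] @ v' = w" by blast
  show ?case
  proof (cases "u' @ [k, l] @ v' = w")
    case True
    with confluence[OF f(2) e(1), of u' v' u v] e(2) have "f - ?e \<in> red_span (\<lambda>t. t \<prec> w)"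
      by (simp add: f(1))
    then have "fscale c (f - ?e) + (g - fscale c' ?e) \<in> red_span (\<lambda>t. t \<prec> w)"
      using c' by (intro red_span_add red_span_scale)
    then show ?thesis
      by (intro exI[of _ "c + c'"]) (simp add: fa.scale_right_diff_distrib fa.scale_left_distrib algebra_simps)
  next
    case False
    with t have "u' @ [k, l] @ v' \<prec> w" by blast
    then have "fscale c f \<in> red_span (\<lambda>t. t \<prec> w)" unfolding f(1) by (intro red_span_scale red_in_red_span f(2))
    from red_span_add[OF this c'] show ?thesis by (intro exI[of _ c']) (simp add: algebra_simps)
  qed
qed

text \<open>
  Minimal counterexample argument: with \<open>w\<close> the least bound for the leading words needed to write
  \<open>f\<close>, the coefficient of \<open>w\<close> in \<open>f\<close> is both the coefficient \<open>c\<close> of the top product and \<open>0\<close>.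
\<close>

theorem red_span_irreducible_eq_zero:
  assumes span: "f \<in> red_span (\<lambda>_. True)"
    and irr: "\<And>w. Poly_Mapping.lookup f (Word w) \<noteq> 0 \<Longrightarrow> irreducible_word w"
  shows "f = 0"
proof (rule ccontr)
  assume nz: "f \<noteq> 0"
  let ?le = "\<lambda>w t. t \<prec> w \<or> t = w"
  let ?Q = "{w. f \<in> red_span (?le w)}"
  obtain w\<^sub>0 where "w\<^sub>0 \<in> ?Q" using red_span_bounded[OF span] nz by auto
  then obtain w where "w \<in> ?Q" "\<And>t. (t, w) \<in> {(v, w). v \<prec> w} \<Longrightarrow> t \<notin> ?Q"
    by (rule wfE_min[OF wf_word_less]) (rule that)
  then have w: "f \<in> red_span (?le w)" and min: "\<And>t. t \<prec> w \<Longrightarrow> f \<notin> red_span (?le t)"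
    by simp_all
  have "f \<in> red_span (\<lambda>t. t \<prec> w)"
  proof (cases "irreducible_word w")
    case True
    then have "{wmon u * red i j * wmon v | u i j v. reducible i j \<and> ?le w (u @ [i, j] @ v)}
        \<subseteq> {wmon u * red i j * wmon v | u i j v. reducible i j \<and> u @ [i, j] @ v \<prec> w}"
      unfolding irreducible_word_def by blast
    from subsetD[OF fa.span_mono[OF this]] w show ?thesis unfolding red_span_def by simp
  next
    case False
    then obtain u i j v where e: "reducible i j" "w = u @ [i, j] @ v" unfolding irreducible_word_def by blast
    then obtain c where c: "f - fscale c (wmon u * red i j * wmon v) \<in> red_span (\<lambda>t. t \<prec> w)"
      using red_span_leading_decomposition w by blast
    have "Poly_Mapping.lookup f (Word w) = 0" using irr False by blast
    with coeff_red_span_less[OF c] coeff_leading[OF e(1), of u v] have "c = 0"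
      by (simp add: e(2) lookup_minus lookup_fscale)
    with c show ?thesis by simp
  qed
  from red_span_bounded[OF this] nz obtain t where "t \<prec> w" "f \<in> red_span (?le t)" by auto
  with min show False by simp
qed

theorem irreducible_normal_form:
  assumes "set w \<subseteq> I"
  shows "wmon w \<in> fa.span ({wmon u * red i j * wmon v | u i j v. reducible i j}
    \<union> {wmon t | t. set t \<subseteq> I \<and> irreducible_word t})" (is "_ \<in> fa.span (?R \<union> ?B)")
  using assms
proof (induction w rule: wf_induct_rule[OF wf_word_less])
  case (1 w)
  show ?case
  proof (cases "irreducible_word w")
    case True
    with 1 show ?thesis by (intro fa.span_base) blast
  next
    case False
    then obtain u i j v where e: "reducible i j" "w = u @ [i, j] @ v" unfolding irreducible_word_def by blast
    let ?e = "wmon u * red i j * wmon v"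
    have "{wmon t | t. t \<prec> w \<and> set t \<subseteq> set w \<union> I} \<subseteq> fa.span (?R \<union> ?B)"
      using 1 by auto
    then have "below w \<subseteq> fa.span (?R \<union> ?B)"
      unfolding below_def by (rule fa.span_minimal) simp
    with leading_in_below[OF e(1)] e(2) have "?e - wmon w \<in> fa.span (?R \<union> ?B)" by blast
    moreover have "?e \<in> fa.span (?R \<union> ?B)" using e(1) by (intro fa.span_base) blast
    ultimately have "?e - (?e - wmon w) \<in> fa.span (?R \<union> ?B)" by (rule fa.span_diff[rotated])
    then show ?thesis by simp
  qed
qed

lemma ordered_indices_eq: "ordered_indices I d \<epsilon> = {w. set w \<subseteq> I \<and> irreducible_word w}"
proof -
  have "irreducible_word w \<longleftrightarrow> (\<forall>j. Suc j < length w \<longrightarrow>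
      w ! j \<le> w ! Suc j \<and> (\<epsilon> (d (w ! j)) (d (w ! j)) \<noteq> 1 \<longrightarrow> w ! j < w ! Suc j))"
    if w: "set w \<subseteq> I" for w
  proof -
    have "irreducible_word w \<longleftrightarrow> (\<forall>j. Suc j < length w \<longrightarrow> \<not> reducible (w ! j) (w ! Suc j))"
    proof safe
      fix j assume "irreducible_word w" and j: "Suc j < length w" and b: "reducible (w ! j) (w ! Suc j)"
      have "w = take j w @ [w ! j, w ! Suc j] @ drop (Suc (Suc j)) w"
        using j by (simp add: Cons_nth_drop_Suc)
      then show False using b \<open>irreducible_word w\<close> unfolding irreducible_word_def by blast
    next
      assume *: "\<forall>j. Suc j < length w \<longrightarrow> \<not> reducible (w ! j) (w ! Suc j)"
      have "\<not> reducible i j" if "w = u @ [i, j] @ v" for u i j v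
        using *[rule_format, of "length u"] that by (simp add: nth_append)
      then show "irreducible_word w" unfolding irreducible_word_def by blast
    qed
    moreover have "w ! j \<in> I \<and> w ! Suc j \<in> I" if "Suc j < length w" for j
      using w that by (auto dest: Suc_lessD)
    moreover have "\<not> reducible i j \<longleftrightarrow> i \<le> j \<and> (\<epsilon> (d i) (d i) \<noteq> 1 \<longrightarrow> i < j)" if "i \<in> I" "j \<in> I" for i j
      using that by (cases i j rule: linorder_cases) (auto simp: reducible_def)
    ultimately show ?thesis by simp
  qed
  then show ?thesis unfolding ordered_indices_def by blast
qed

end

section \<open>Ring homomorphisms out of a type-based ring\<close>

lemma ring_of_type_algebra_simps:
  "carrier ring_of_type_algebra = UNIV" "monoid.mult ring_of_type_algebra = (*)"
  "ring.add ring_of_type_algebra = (+)" "one ring_of_type_algebra = 1" "ring.zero ring_of_type_algebra = 0"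
  by (simp_all add: ring_of_type_algebra_def)

lemma uminus_ring_of_type_algebra: "\<ominus>\<^bsub>ring_of_type_algebra\<^esub> (a :: 'a::ring_1) = - a"
proof -
  interpret ring "ring_of_type_algebra :: 'a ring" by (rule ring_ring_of_type_algebra)
  show ?thesis by (rule minus_equality) (simp_all add: ring_of_type_algebra_simps)
qed

lemma minus_ring_of_type_algebra: "a \<ominus>\<^bsub>ring_of_type_algebra\<^esub> (b :: 'a::ring_1) = a - b"
  by (simp add: a_minus_def uminus_ring_of_type_algebra ring_of_type_algebra_simps)

lemma type_ring_hom:
  fixes h :: "'a::ring_1 \<Rightarrow> 'b"
  assumes h: "h \<in> ring_hom ring_of_type_algebra A" and A: "ring A"
  shows "h a \<in> carrier A" "h (a + b) = h a \<oplus>\<^bsub>A\<^esub> h b" "h (a * b) = h a \<otimes>\<^bsub>A\<^esub> h b"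
    "h 1 = \<one>\<^bsub>A\<^esub>" "h 0 = \<zero>\<^bsub>A\<^esub>" "h (- a) = \<ominus>\<^bsub>A\<^esub> h a" "h (a - b) = h a \<ominus>\<^bsub>A\<^esub> h b"
proof -
  interpret ring_hom_ring "ring_of_type_algebra :: 'a ring" A h
    by (intro ring_hom_ringI2 ring_ring_of_type_algebra A h)
  show *: "h a \<in> carrier A" "h (a + b) = h a \<oplus>\<^bsub>A\<^esub> h b" "h (a * b) = h a \<otimes>\<^bsub>A\<^esub> h b"
    "h 1 = \<one>\<^bsub>A\<^esub>" "h 0 = \<zero>\<^bsub>A\<^esub>" for a b
    using hom_closed[of a] hom_add[of a b] hom_mult[of a b] hom_one hom_zero
    by (simp_all add: ring_of_type_algebra_simps)
  show **: "h (- a) = \<ominus>\<^bsub>A\<^esub> h a" for a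
    using hom_a_inv[of a] by (simp add: uminus_ring_of_type_algebra ring_of_type_algebra_simps)
  show "h (a - b) = h a \<ominus>\<^bsub>A\<^esub> h b"
    using *(2)[of a "- b"] by (simp add: ** a_minus_def)
qed

text \<open>
  Two-sided ideals of a type-based ring are given here by closure properties of a set, as the free
  algebras are types; a surjective homomorphism carries such a set to an ideal of a carrier-based ring.
\<close>

lemma ideal_image:
  fixes K :: "'a::ring_1 set"
  assumes "0 \<in> K" "\<And>a b. a \<in> K \<Longrightarrow> b \<in> K \<Longrightarrow> a + b \<in> K"
    and "\<And>a b. a \<in> K \<Longrightarrow> b * a \<in> K" "\<And>a b. a \<in> K \<Longrightarrow> a * b \<in> K"
    and h: "h \<in> ring_hom ring_of_type_algebra A" and A: "ring A" and surj: "carrier A = range h"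
  shows "ideal (h ` K) A"
proof -
  interpret A: ring A by fact
  note hom = type_ring_hom[OF h A]
  have neg: "- a \<in> K" if "a \<in> K" for a using assms(3)[of a "-1"] that by simp
  show ?thesis
  proof (rule idealI[OF A])
    show "subgroup (h ` K) (add_monoid A)"
    proof (rule subgroup.intro)
      show "h ` K \<subseteq> carrier (add_monoid A)" using hom(1) by auto
      show "a \<otimes>\<^bsub>add_monoid A\<^esub> b \<in> h ` K" if "a \<in> h ` K" "b \<in> h ` K" for a b
        using that assms(2) by (auto simp flip: hom)
      show "\<one>\<^bsub>add_monoid A\<^esub> \<in> h ` K" using assms(1) by (auto simp flip: hom(5))
      show "inv\<^bsub>add_monoid A\<^esub> a \<in> h ` K" if "a \<in> h ` K" for a
        using that neg by (auto simp only: hom(6)[unfolded a_inv_def, symmetric])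
    qed
  qed (use surj assms(3,4) in \<open>auto simp flip: hom\<close>)
qed

section \<open>The enveloping algebra as a quotient of the free algebra\<close>

context color_lie_algebra
begin

text \<open>
  Both quotients at once: elements of the enveloping algebra are cosets of cosets of the free algebra.
\<close>

definition quot_map :: "('l \<Rightarrow> 'l \<Rightarrow> 'k) \<Rightarrow> ('k, 'l) free_algebra \<Rightarrow> ('k, 'l) free_algebra set set" where
  "quot_map \<omega> f = enveloping_ideal scale L \<epsilon> br \<omega> +>\<^bsub>tensor_algebra scale\<^esub>
     (linearity_ideal scale +>\<^bsub>free_ring\<^esub> f)"

abbreviation quot_ring :: "('l \<Rightarrow> 'l \<Rightarrow> 'k) \<Rightarrow> ('k, 'l) free_algebra set set ring" where
  "quot_ring \<omega> \<equiv> tensor_algebra scale Quot enveloping_ideal scale L \<epsilon> br \<omega>"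

definition lifted_rel :: "('l \<Rightarrow> 'l \<Rightarrow> 'k) \<Rightarrow> 'g \<Rightarrow> 'g \<Rightarrow> 'l \<Rightarrow> 'l \<Rightarrow> ('k, 'l) free_algebra" where
  "lifted_rel \<omega> g h a b = free_gen a * free_gen b - free_scalar (\<epsilon> g h) * (free_gen b * free_gen a)
     - free_gen (br a b) - free_scalar (\<omega> a b)"

lemma ideal_linearity: "ideal (linearity_ideal scale :: ('k, 'l) free_algebra set) free_ring"
  unfolding linearity_ideal_def
  by (intro ring.genideal_ideal ring_ring_of_type_algebra) (simp add: ring_of_type_algebra_def)

lemma tensor_hom: "(+>\<^bsub>free_ring\<^esub>) (linearity_ideal scale) \<in> ring_hom free_ring (tensor_algebra scale)"
  unfolding tensor_algebra_def by (rule ideal.rcos_ring_hom[OF ideal_linearity])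

lemma carrier_tensor: "carrier (tensor_algebra scale) = range ((+>\<^bsub>free_ring\<^esub>) (linearity_ideal scale))"
  by (auto simp: tensor_algebra_def FactRing_def A_RCOSETS_def' ring_of_type_algebra_simps)

lemma ring_quot_ring: "ring (quot_ring \<omega>)"
  by (rule ideal.quotient_is_ring[OF ideal_enveloping_ideal])

lemma quot_map_hom: "quot_map \<omega> \<in> ring_hom free_ring (quot_ring \<omega>)"
  using ring_hom_trans[OF tensor_hom ideal.rcos_ring_hom[OF ideal_enveloping_ideal]]
  by (simp add: comp_def quot_map_def[abs_def])

lemma carrier_quot_ring: "carrier (quot_ring \<omega>) = range (quot_map \<omega>)"
  unfolding quot_map_def
  by (auto simp: FactRing_def A_RCOSETS_def' carrier_tensor)

lemmas quot_map_simps = type_ring_hom[OF quot_map_hom ring_quot_ring]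

definition relation_ideal :: "('l \<Rightarrow> 'l \<Rightarrow> 'k) \<Rightarrow> ('k, 'l) free_algebra set" where
  "relation_ideal \<omega> = {f. quot_map \<omega> f = \<zero>\<^bsub>quot_ring \<omega>\<^esub>}"

lemma quot_map_eq_iff: "quot_map \<omega> f = quot_map \<omega> g \<longleftrightarrow> f - g \<in> relation_ideal \<omega>"
proof -
  interpret Q: ring "quot_ring \<omega>" by (rule ring_quot_ring)
  show ?thesis
    by (auto simp: relation_ideal_def quot_map_simps Q.r_right_minus_eq)
qed

lemma relation_ideal_iff: "f \<in> relation_ideal \<omega> \<longleftrightarrow> linearity_ideal scale +>\<^bsub>free_ring\<^esub> f \<in> enveloping_ideal scale L \<epsilon> br \<omega>"
proof -
  interpret E: ideal "enveloping_ideal scale L \<epsilon> br \<omega>" "tensor_algebra scale"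
    by (rule ideal_enveloping_ideal)
  have zero: "\<zero>\<^bsub>quot_ring \<omega>\<^esub> = enveloping_ideal scale L \<epsilon> br \<omega>"
    by (simp add: FactRing_def)
  have "linearity_ideal scale +>\<^bsub>free_ring\<^esub> f \<in> carrier (tensor_algebra scale)"
    by (simp add: carrier_tensor)
  then show ?thesis
    unfolding relation_ideal_def zero quot_map_def
    using E.rcos_const_imp_mem E.a_rcos_const by blast
qed

lemma relation_ideal_add: "f \<in> relation_ideal \<omega> \<Longrightarrow> g \<in> relation_ideal \<omega> \<Longrightarrow> f + g \<in> relation_ideal \<omega>"
  and relation_ideal_mult_left: "g \<in> relation_ideal \<omega> \<Longrightarrow> f * g \<in> relation_ideal \<omega>"
  and relation_ideal_mult_right: "f \<in> relation_ideal \<omega> \<Longrightarrow> f * g \<in> relation_ideal \<omega>"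
  and relation_ideal_zero: "0 \<in> relation_ideal \<omega>"
  and relation_ideal_scale: "f \<in> relation_ideal \<omega> \<Longrightarrow> fscale c f \<in> relation_ideal \<omega>"
proof -
  interpret Q: ring "quot_ring \<omega>" by (rule ring_quot_ring)
  show "f \<in> relation_ideal \<omega> \<Longrightarrow> g \<in> relation_ideal \<omega> \<Longrightarrow> f + g \<in> relation_ideal \<omega>"
    "f \<in> relation_ideal \<omega> \<Longrightarrow> f * g \<in> relation_ideal \<omega>" "0 \<in> relation_ideal \<omega>"
    and *: "g \<in> relation_ideal \<omega> \<Longrightarrow> f * g \<in> relation_ideal \<omega>" for f g
    by (auto simp: relation_ideal_def quot_map_simps)
  show "f \<in> relation_ideal \<omega> \<Longrightarrow> fscale c f \<in> relation_ideal \<omega>" by (simp add: fscale_def *)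
qed

lemma linearity_relation_in_ideal: "r \<in> linearity_relations scale \<Longrightarrow> r \<in> relation_ideal \<omega>"
proof -
  assume r: "r \<in> linearity_relations scale"
  interpret T: ring "tensor_algebra scale" by (rule ring_tensor_algebra)
  interpret lin: ideal "linearity_ideal scale" "free_ring :: ('k, 'l) free_algebra ring"
    by (rule ideal_linearity)
  interpret E: ideal "enveloping_ideal scale L \<epsilon> br \<omega>" "tensor_algebra scale"
    by (rule ideal_enveloping_ideal)
  have "r \<in> linearity_ideal scale"
    using r ring.genideal_self[OF ring_ring_of_type_algebra, of "linearity_relations scale"]
    by (auto simp: linearity_ideal_def ring_of_type_algebra_simps)
  then have "linearity_ideal scale +>\<^bsub>free_ring\<^esub> r = \<zero>\<^bsub>tensor_algebra scale\<^esub>"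
    by (simp add: lin.a_rcos_const tensor_algebra_def FactRing_def)
  then show ?thesis by (simp add: relation_ideal_iff)
qed

lemma lifted_rel_image:
  "linearity_ideal scale +>\<^bsub>free_ring\<^esub> lifted_rel \<omega> g h a b =
    (let T = tensor_algebra scale; t = tensor_gen scale; s = tensor_scalar scale in
      t a \<otimes>\<^bsub>T\<^esub> t b \<ominus>\<^bsub>T\<^esub> s (\<epsilon> g h) \<otimes>\<^bsub>T\<^esub> (t b \<otimes>\<^bsub>T\<^esub> t a) \<ominus>\<^bsub>T\<^esub> t (br a b) \<ominus>\<^bsub>T\<^esub> s (\<omega> a b))"
  unfolding lifted_rel_def Let_def tensor_gen_def tensor_scalar_def
  by (simp add: type_ring_hom[OF tensor_hom ring_tensor_algebra])

lemma enveloping_relations_eq: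
  "enveloping_relations scale L \<epsilon> br \<omega> =
    {linearity_ideal scale +>\<^bsub>free_ring\<^esub> lifted_rel \<omega> g h a b | g h a b. a \<in> L g \<and> b \<in> L h}"
  unfolding lifted_rel_image enveloping_relations_def Let_def by (rule refl)

lemma lifted_rel_in_ideal:
  assumes "a \<in> L g" "b \<in> L h"
  shows "lifted_rel \<omega> g h a b \<in> relation_ideal \<omega>"
proof -
  interpret T: ring "tensor_algebra scale" by (rule ring_tensor_algebra)
  have closed: "enveloping_relations scale L \<epsilon> br \<omega> \<subseteq> carrier (tensor_algebra scale)"
    unfolding enveloping_relations_eq using type_ring_hom(1)[OF tensor_hom ring_tensor_algebra] by blast
  have "linearity_ideal scale +>\<^bsub>free_ring\<^esub> lifted_rel \<omega> g h a b \<in> enveloping_relations scale L \<epsilon> br \<omega>"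
    unfolding enveloping_relations_eq using assms by blast
  then show ?thesis
    unfolding relation_ideal_iff enveloping_ideal_def using T.genideal_self[OF closed] by blast
qed

text \<open>
  Together with \<open>linearity_relation_in_ideal\<close> and \<open>lifted_rel_in_ideal\<close> this says that the kernel of
  the composite quotient map is the two-sided ideal generated by both families of relations. The
  image of \<open>K\<close> in the tensor algebra contains the enveloping ideal, and \<open>K\<close> contains the kernel of
  the map to the tensor algebra, so \<open>K\<close> is saturated.
\<close>

lemma relation_ideal_minimal:
  assumes K: "0 \<in> K" "\<And>a b. a \<in> K \<Longrightarrow> b \<in> K \<Longrightarrow> a + b \<in> K"
      "\<And>a b. a \<in> K \<Longrightarrow> b * a \<in> K" "\<And>a b. a \<in> K \<Longrightarrow> a * b \<in> K"
    and lin: "linearity_relations scale \<subseteq> K"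
    and env: "\<And>g h a b. a \<in> L g \<Longrightarrow> b \<in> L h \<Longrightarrow> lifted_rel \<omega> g h a b \<in> K"
  shows "relation_ideal \<omega> \<subseteq> K"
proof
  fix f assume "f \<in> relation_ideal \<omega>"
  interpret T: ring "tensor_algebra scale" by (rule ring_tensor_algebra)
  let ?p = "(+>\<^bsub>free_ring\<^esub>) (linearity_ideal scale)"
  have "id \<in> ring_hom free_ring (free_ring :: ('k, 'l) free_algebra ring)"
    by (rule ring_hom_memI) (auto simp: ring_of_type_algebra_simps)
  from ideal_image[OF K this ring_ring_of_type_algebra] have "ideal K free_ring"
    by (simp add: ring_of_type_algebra_simps)
  then have lin_K: "linearity_ideal scale \<subseteq> K"
    unfolding linearity_ideal_def using lin by (intro ring.genideal_minimal ring_ring_of_type_algebra)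
  have "ideal (?p ` K) (tensor_algebra scale)"
    by (rule ideal_image[OF K tensor_hom ring_tensor_algebra carrier_tensor])
  moreover have "enveloping_relations scale L \<epsilon> br \<omega> \<subseteq> ?p ` K"
    unfolding enveloping_relations_eq using env by blast
  ultimately have "enveloping_ideal scale L \<epsilon> br \<omega> \<subseteq> ?p ` K"
    unfolding enveloping_ideal_def by (rule T.genideal_minimal)
  with \<open>f \<in> relation_ideal \<omega>\<close> obtain k where k: "k \<in> K" "?p f = ?p k" by (auto simp: relation_ideal_iff)
  have "f \<ominus>\<^bsub>free_ring\<^esub> k \<in> linearity_ideal scale"
    using k(2) ring.quotient_eq_iff_same_a_r_cos[OF ring_ring_of_type_algebra ideal_linearity, of f k]
    by (simp add: ring_of_type_algebra_simps)
  then have "f - k \<in> K" using lin_K by (auto simp: minus_ring_of_type_algebra)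
  from K(2)[OF this k(1)] show "f \<in> K" by simp
qed

end

context color_enveloping
begin

section \<open>Comparison of the two presentations\<close>

definition to_basis :: "('k, 'l) free_algebra \<Rightarrow> ('k, 'i) free_algebra" where
  "to_basis = lift iota"

definition from_basis :: "('k, 'i) free_algebra \<Rightarrow> ('k, 'l) free_algebra" where
  "from_basis = lift (\<lambda>i. free_gen (x i))"

lemma to_basis_simps:
  "to_basis (f + g) = to_basis f + to_basis g" "to_basis (f - g) = to_basis f - to_basis g"
  "to_basis (f * g) = to_basis f * to_basis g" "to_basis (fscale c f) = fscale c (to_basis f)"
  "to_basis 0 = 0" "to_basis 1 = 1" "to_basis (free_gen a) = iota a"
  "to_basis (wmon (a # w)) = iota a * to_basis (wmon w)"
  by (simp_all add: to_basis_def lift_add lift_diff lift_mult lift_fscale lift_zero lift_one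
      lift_free_gen lift_wmon)

lemma from_basis_simps:
  "from_basis (f + g) = from_basis f + from_basis g" "from_basis (f - g) = from_basis f - from_basis g"
  "from_basis (f * g) = from_basis f * from_basis g" "from_basis (fscale c f) = fscale c (from_basis f)"
  "from_basis 0 = 0" "from_basis 1 = 1" "from_basis (wmon []) = 1"
  "from_basis (wmon (i # w)) = free_gen (x i) * from_basis (wmon w)"
  by (simp_all add: from_basis_def lift_add lift_diff lift_mult lift_fscale lift_zero lift_one lift_wmon)

lemma red_span_mult_left: "g \<in> red_span (\<lambda>_. True) \<Longrightarrow> f * g \<in> red_span (\<lambda>_. True)"
  by (induction f rule: free_algebra_induct)
    (simp_all add: red_span_context_left distrib_right red_span_add fscale_mult_left red_span_scale)

lemma red_span_mult_right: "g \<in> red_span (\<lambda>_. True) \<Longrightarrow> g * f \<in> red_span (\<lambda>_. True)"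
  by (induction f rule: free_algebra_induct)
    (simp_all add: red_span_context_right distrib_left red_span_add fscale_mult_right red_span_scale)

text \<open>
  Expansion in the basis respects the relations; this is the direction that independence needs.
\<close>

lemma to_basis_relation_ideal: "f \<in> relation_ideal \<omega> \<Longrightarrow> to_basis f \<in> red_span (\<lambda>_. True)"
proof -
  have "relation_ideal \<omega> \<subseteq> {f. to_basis f \<in> red_span (\<lambda>_. True)}"
  proof (rule relation_ideal_minimal)
    show "linearity_relations scale \<subseteq> {f. to_basis f \<in> red_span (\<lambda>_. True)}"
      by (auto simp: linearity_relations_def to_basis_simps iota_add iota_scale red_span_zero simp flip: fscale_def)
    fix g h a b assume "a \<in> L g" "b \<in> L h"
    then have "rel g h a b \<in> red_span (\<lambda>_. True)" by (rule rel_in_red_span) simp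
    then show "lifted_rel \<omega> g h a b \<in> {f. to_basis f \<in> red_span (\<lambda>_. True)}"
      by (simp add: lifted_rel_def rel_def to_basis_simps free_scalar_eq_fscale fscale_mult_left)
  qed (auto simp: to_basis_simps red_span_zero red_span_add red_span_mult_left red_span_mult_right)
  then show "f \<in> relation_ideal \<omega> \<Longrightarrow> to_basis f \<in> red_span (\<lambda>_. True)" by blast
qed

lemma from_basis_iota: "free_gen a - from_basis (iota a) \<in> relation_ideal \<omega>"
proof -
  have add: "free_gen (a + b) - free_gen a - free_gen b \<in> relation_ideal \<omega>"
    and scale: "free_gen (scale c a) - fscale c (free_gen a) \<in> relation_ideal \<omega>" for a b c
    by (rule linearity_relation_in_ideal, auto simp: linearity_relations_def fscale_def)+
  have "a \<in> span (x ` I)"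
    using homogeneous_basis by (simp add: homogeneous_basis_def)
  then show ?thesis
  proof (induction rule: span_induct_alt)
    case base
    show ?case using scale[of 0 0] by (simp add: iota_zero from_basis_simps)
  next
    case (step c a b)
    then obtain i where i: "i \<in> I" "a = x i" by blast
    have "free_gen (scale c a + b) - from_basis (iota (scale c a + b)) =
        (free_gen (scale c a + b) - free_gen (scale c a) - free_gen b)
        + (free_gen (scale c a) - fscale c (free_gen a)) + (free_gen b - from_basis (iota b))"
      using i by (simp add: iota_add iota_scale iota_x from_basis_simps)
    also have "\<dots> \<in> relation_ideal \<omega>"
      using step.IH by (intro relation_ideal_add add scale)
    finally show ?case .
  qed
qed

lemma from_to_basis: "f - from_basis (to_basis f) \<in> relation_ideal \<omega>"
proof (induction f rule: free_algebra_induct)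
  case (wmon w)
  show ?case
  proof (induction w)
    case Nil
    show ?case by (simp add: wmon_Nil to_basis_simps from_basis_simps relation_ideal_zero)
  next
    case (Cons a w)
    have "wmon (a # w) - from_basis (to_basis (wmon (a # w)))
      = (free_gen a - from_basis (iota a)) * wmon w
        + from_basis (iota a) * (wmon w - from_basis (to_basis (wmon w)))"
      using wmon_append[of "[a]" w]
      by (simp add: free_gen_eq_wmon to_basis_simps from_basis_simps algebra_simps)
    also have "\<dots> \<in> relation_ideal \<omega>"
      using Cons by (intro relation_ideal_add relation_ideal_mult_left relation_ideal_mult_right from_basis_iota)
    finally show ?case .
  qed
next
  case (add f g)
  then have "(f - from_basis (to_basis f)) + (g - from_basis (to_basis g)) \<in> relation_ideal \<omega>" by (rule relation_ideal_add)
  then show ?case by (simp add: to_basis_simps from_basis_simps algebra_simps)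
next
  case (scale c f)
  from relation_ideal_scale[OF this, of c] show ?case
    by (simp add: to_basis_simps from_basis_simps fa.scale_right_diff_distrib)
qed

text \<open>
  Substitution of basis vectors respects the relations; this is the direction that spanning needs.
  The bracket is expanded in the basis on one side only, which accounts for the correction term.
\<close>

lemma from_basis_red: "reducible i j \<Longrightarrow> from_basis (red i j) \<in> relation_ideal \<omega>"
proof -
  assume "reducible i j"
  then have I: "i \<in> I" "j \<in> I" by (auto simp: reducible_def)
  let ?b = "br (x i) (x j)"
  have "from_basis (basis_rel i j) =
      lifted_rel \<omega> (d i) (d j) (x i) (x j) + (free_gen ?b - from_basis (iota ?b))"
    using I by (simp add: basis_rel_def rel_def lifted_rel_def from_basis_simps iota_x
        free_scalar_eq_fscale fscale_mult_left algebra_simps)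
  also have "\<dots> \<in> relation_ideal \<omega>"
    by (intro relation_ideal_add lifted_rel_in_ideal x_degree I from_basis_iota)
  finally show ?thesis by (auto simp: red_def from_basis_simps intro: relation_ideal_scale)
qed

lemma to_from_basis: "set w \<subseteq> I \<Longrightarrow> to_basis (from_basis (wmon w)) = wmon w"
proof (induction w)
  case Nil
  show ?case by (simp add: wmon_Nil to_basis_simps from_basis_simps)
next
  case (Cons i w)
  then show ?case
    by (simp add: to_basis_simps from_basis_simps iota_x flip: wmon_append)
qed

lemma to_basis_span: "to_basis f \<in> fa.span {wmon w | w. set w \<subseteq> I}" (is "_ \<in> ?S")
proof (induction f rule: free_algebra_induct)
  case (wmon w)
  show ?case
  proof (induction w)
    case Nil
    show ?case by (auto simp: wmon_Nil to_basis_simps intro!: fa.span_base exI[of _ "[]"])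
  next
    case (Cons a w)
    have letter: "wmon [i] * f \<in> ?S" if "i \<in> I" "f \<in> ?S" for i f
      using that(2)
    proof (induction rule: fa.span_induct_alt)
      case (step c f g)
      then obtain v where "f = wmon v" "set v \<subseteq> I" by blast
      then have "wmon [i] * f \<in> ?S"
        using that(1) by (auto intro!: fa.span_base exI[of _ "i # v"] simp flip: wmon_append)
      with step show ?case
        by (simp add: distrib_left fscale_mult_right fa.span_add fa.span_scale)
    qed (simp add: fa.span_zero)
    have "a \<in> span (x ` I)"
      using homogeneous_basis by (simp add: homogeneous_basis_def)
    then have "iota a * to_basis (wmon w) \<in> ?S"
    proof (induction rule: span_induct_alt)
      case base
      show ?case by (simp add: iota_zero fa.span_zero)
    next
      case (step c b b')
      then have "iota b * to_basis (wmon w) \<in> ?S"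
        using Cons by (auto simp: iota_x intro: letter)
      with step show ?case
        by (simp add: iota_add iota_scale distrib_right fscale_mult_left fa.span_add fa.span_scale)
    qed
    then show ?case by (simp add: to_basis_simps)
  qed
qed (simp_all add: to_basis_simps fa.span_add fa.span_scale)

section \<open>Monomials in the enveloping algebra\<close>

abbreviation U where "U \<equiv> enveloping_algebra scale L \<epsilon> br \<omega>"

definition ord_monomial where
  "ord_monomial = monomial U (\<lambda>i. canonical_image scale L \<epsilon> br \<omega> (x i))"

lemma U_simps: "carrier U = range (quot_map \<omega>)" "monoid.mult U = monoid.mult (quot_ring \<omega>)"
  "one U = one (quot_ring \<omega>)" "ring.zero U = ring.zero (quot_ring \<omega>)"
  "ring.add U = ring.add (quot_ring \<omega>)"
  "c \<odot>\<^bsub>U\<^esub> quot_map \<omega> f = quot_map \<omega> (fscale c f)"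
  by (simp_all add: enveloping_algebra_def ring_module_def tensor_scalar_def
      fscale_def quot_map_simps flip: carrier_quot_ring quot_map_def)

lemma ord_monomial_eq: "ord_monomial w = quot_map \<omega> (from_basis (wmon w))"
proof (induction w)
  case Nil
  show ?case by (simp add: ord_monomial_def monomial_def U_simps wmon_Nil from_basis_simps quot_map_simps)
next
  case (Cons i w)
  then show ?case
    by (simp add: ord_monomial_def monomial_def U_simps from_basis_simps quot_map_simps
        canonical_image_def tensor_gen_def flip: quot_map_def)
qed

text \<open>
  A linear relation between ordered monomials in the enveloping algebra is carried by \<open>to_basis\<close> to a
  combination of irreducible words in the ideal generated by the \<open>red i j\<close>, which vanishes.
  The sum runs over words rather than over monomials, so that injectivity is a consequence as well.
\<close>

lemma combination_in_ideal_imp_zero: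
  assumes "finite A" "A \<subseteq> ordered_indices I d \<epsilon>"
    and null: "(\<Sum>w\<in>A. fscale (c w) (from_basis (wmon w))) \<in> relation_ideal \<omega>"
    and w: "w \<in> A"
  shows "c w = 0"
proof -
  let ?f = "\<Sum>w\<in>A. fscale (c w) (wmon w)"
  have coeff: "Poly_Mapping.lookup ?f (Word v) = (if v \<in> A then c v else 0)" for v
    using assms(1) by (simp add: lookup_sum lookup_fscale lookup_wmon if_distrib[of "(*) _"] cong: if_cong)
  have "to_basis (\<Sum>w\<in>B. fscale (c w) (from_basis (wmon w))) = (\<Sum>w\<in>B. fscale (c w) (wmon w))"
    if "finite B" "B \<subseteq> A" for B
    using that
  proof (induction rule: finite_induct)
    case (insert w B)
    then have "set w \<subseteq> I" using assms(2) by (auto simp: ordered_indices_eq)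
    with insert show ?case by (simp add: to_basis_simps to_from_basis)
  qed (simp add: to_basis_simps)
  then have "?f \<in> red_span (\<lambda>_. True)" using to_basis_relation_ideal[OF null] assms(1) by simp
  moreover have "irreducible_word v" if "Poly_Mapping.lookup ?f (Word v) \<noteq> 0" for v
    using that assms(2) by (auto simp: coeff ordered_indices_eq split: if_splits)
  ultimately have "?f = 0" by (rule red_span_irreducible_eq_zero)
  with coeff[of w] w show ?thesis by simp
qed

lemma inj_ord_monomial: "inj_on ord_monomial (ordered_indices I d \<epsilon>)"
proof (rule inj_onI, rule ccontr)
  fix v w assume vw: "v \<in> ordered_indices I d \<epsilon>" "w \<in> ordered_indices I d \<epsilon>"
    and eq: "ord_monomial v = ord_monomial w" and neq: "v \<noteq> w"
  let ?c = "\<lambda>u. if u = v then 1 else - 1"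
  have "(\<Sum>u\<in>{v, w}. fscale (?c u) (from_basis (wmon u))) \<in> relation_ideal \<omega>"
    using eq neq by (simp add: ord_monomial_eq quot_map_eq_iff)
  from combination_in_ideal_imp_zero[OF _ _ this, of v] vw show False by simp
qed

sublocale V: vectorspace "ring_of_type_algebra :: 'k ring" U
  by (rule vectorspace_enveloping_algebra)

text \<open>
  The combination ranges over a set of cosets; \<open>s\<close> picks a representative of each.
\<close>

lemma lincomb_quot_map:
  assumes "finite A" "\<And>v. v \<in> A \<Longrightarrow> v = quot_map \<omega> (s v)"
  shows "V.lincomb c A = quot_map \<omega> (\<Sum>v\<in>A. fscale (c v) (s v))"
  using assms
proof (induction rule: finite_induct)
  case empty
  show ?case by (simp add: V.lincomb_def U_simps quot_map_simps)
next
  case (insert v A)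
  have "insert v A \<subseteq> carrier U" using insert.prems unfolding U_simps by blast
  then have "V.lincomb c (insert v A) = c v \<odot>\<^bsub>U\<^esub> v \<oplus>\<^bsub>U\<^esub> V.lincomb c A"
    using V.lincomb_insert[of A c v] insert.hyps by (simp add: ring_of_type_algebra_simps)
  moreover have "c v \<odot>\<^bsub>U\<^esub> v = quot_map \<omega> (fscale (c v) (s v))"
    using U_simps(6)[of "c v" "s v"] insert.prems[of v] by simp
  ultimately show ?case
    using insert by (simp add: U_simps quot_map_simps)
qed

lemma monomials_independent: "V.lin_indpt (ord_monomial ` ordered_indices I d \<epsilon>)"
proof
  assume "V.lin_dep (ord_monomial ` ordered_indices I d \<epsilon>)"
  then obtain A c v where A: "finite A" "A \<subseteq> ord_monomial ` ordered_indices I d \<epsilon>"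
    and comb: "V.lincomb c A = \<zero>\<^bsub>U\<^esub>" and v: "v \<in> A" "c v \<noteq> \<zero>\<^bsub>ring_of_type_algebra\<^esub>"
    unfolding V.lin_dep_def by blast
  obtain B where B: "B \<subseteq> ordered_indices I d \<epsilon>" "A = ord_monomial ` B"
    using A(2) by (auto simp: subset_image_iff)
  have inj: "inj_on ord_monomial B"
    using inj_ord_monomial B(1) by (rule inj_on_subset)
  then have fin: "finite B" using A(1) B(2) by (simp add: finite_image_iff)
  let ?s = "\<lambda>v. from_basis (wmon (the_inv_into B ord_monomial v))"
  have "V.lincomb c A = quot_map \<omega> (\<Sum>v\<in>A. fscale (c v) (?s v))"
    using A(1) by (rule lincomb_quot_map) (auto simp: B(2) the_inv_into_f_f[OF inj] simp flip: ord_monomial_eq)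
  also have "(\<Sum>v\<in>A. fscale (c v) (?s v)) = (\<Sum>w\<in>B. fscale (c (ord_monomial w)) (from_basis (wmon w)))"
    unfolding B(2) by (subst sum.reindex[OF inj]) (auto intro!: sum.cong simp: the_inv_into_f_f[OF inj])
  finally have "(\<Sum>w\<in>B. fscale (c (ord_monomial w)) (from_basis (wmon w))) \<in> relation_ideal \<omega>"
    using comb by (simp add: relation_ideal_def U_simps)
  from combination_in_ideal_imp_zero[OF fin B(1) this] v show False
    by (auto simp: B(2) ring_of_type_algebra_simps)
qed

lemma monomials_closed: "ord_monomial ` ordered_indices I d \<epsilon> \<subseteq> carrier U"
  by (auto simp: ord_monomial_eq U_simps)

lemma monomials_generate: "V.gen_set (ord_monomial ` ordered_indices I d \<epsilon>)"
proof
  let ?M = "ord_monomial ` ordered_indices I d \<epsilon>"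
  show "V.span ?M \<subseteq> carrier U" by (rule V.span_is_subset2[OF monomials_closed])
  \<comment> \<open>it suffices to lift the span to the free algebra on the basis, where it contains the ideal and the irreducible words\<close>
  interpret S: submodule "ring_of_type_algebra :: 'k ring" "V.span ?M" U
    by (rule V.span_is_submodule[OF monomials_closed])
  let ?P = "\<lambda>f. quot_map \<omega> (from_basis f) \<in> V.span ?M"
  have add: "?P (fscale c f + g)" if "?P f" "?P g" for c f g
  proof -
    have "quot_map \<omega> (from_basis (fscale c f + g))
        = c \<odot>\<^bsub>U\<^esub> quot_map \<omega> (from_basis f) \<oplus>\<^bsub>U\<^esub> quot_map \<omega> (from_basis g)"
      by (simp add: from_basis_simps U_simps quot_map_simps)
    also have "\<dots> \<in> V.span ?M"
      using that by (intro S.m_closed S.smult_closed) (simp_all add: ring_of_type_algebra_simps)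
    finally show ?thesis .
  qed
  have zero: "?P 0"
    using S.zero_closed by (simp add: from_basis_simps quot_map_simps U_simps)
  have word: "?P (wmon w)" if "set w \<subseteq> I" for w
    using irreducible_normal_form[OF that]
  proof (induction rule: fa.span_induct_alt)
    case base
    show ?case by (rule zero)
  next
    case (step c f g)
    have "?P f"
      using step.hyps(1)
    proof
      assume "f \<in> {wmon u * red i j * wmon v | u i j v. reducible i j}"
      then have "from_basis f \<in> relation_ideal \<omega>"
        by (auto simp: from_basis_simps relation_ideal_mult_left relation_ideal_mult_right from_basis_red)
      then show ?thesis using zero by (simp add: relation_ideal_def from_basis_simps quot_map_simps)
    next
      assume "f \<in> {wmon t | t. set t \<subseteq> I \<and> irreducible_word t}"
      then have "quot_map \<omega> (from_basis f) \<in> ?M"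
        by (auto simp: ordered_indices_eq simp flip: ord_monomial_eq)
      then show ?thesis using V.in_own_span[OF monomials_closed] by blast
    qed
    then show ?case using step.IH by (rule add)
  qed
  show "carrier U \<subseteq> V.span ?M"
  proof
    fix u assume "u \<in> carrier U"
    then obtain f where u: "u = quot_map \<omega> f" by (auto simp: U_simps)
    have "?P h" if "h \<in> fa.span {wmon w | w. set w \<subseteq> I}" for h
      using that by (induction rule: fa.span_induct_alt) (auto intro: zero add word)
    from this[OF to_basis_span] from_to_basis[of f] show "u \<in> V.span ?M"
      by (simp add: u flip: quot_map_eq_iff)
  qed
qed

theorem ord_monomial_basis: "V.basis (ord_monomial ` ordered_indices I d \<epsilon>)"
  unfolding V.basis_def
  using monomials_independent monomials_generate monomials_closed by blast

end

theorem theorem2p1: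
  fixes scale :: "'k::field_char_0 \<Rightarrow> 'l::ab_group_add \<Rightarrow> 'l"
    and L :: "'g::ab_group_add \<Rightarrow> 'l set"
    and \<epsilon> :: "'g \<Rightarrow> 'g \<Rightarrow> 'k"
    and br :: "'l \<Rightarrow> 'l \<Rightarrow> 'l"
    and \<omega> :: "'l \<Rightarrow> 'l \<Rightarrow> 'k"
    and I :: "'i::wellorder set"
    and x :: "'i \<Rightarrow> 'l"
    and d :: "'i \<Rightarrow> 'g"
  defines "U \<equiv> enveloping_algebra scale L \<epsilon> br \<omega>"
    and "z \<equiv> \<lambda>i. canonical_image scale L \<epsilon> br \<omega> (x i)"
  assumes "color_lie_algebra scale L \<epsilon> br"
    and "graded_vector_space.homogeneous_basis scale L I x d"
    and "\<omega> \<in> color_lie_algebra.Z2_gr scale L \<epsilon> br"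
  shows "inj_on (monomial U z) (ordered_indices I d \<epsilon>) \<and>
         vectorspace.basis (ring_of_type_algebra :: 'k ring) U
           (monomial U z ` ordered_indices I d \<epsilon>)"
proof -
  interpret color_enveloping scale L \<epsilon> br \<omega> I x d
    by (intro color_enveloping.intro color_enveloping_axioms.intro assms)
  show ?thesis
    using inj_ord_monomial ord_monomial_basis unfolding ord_monomial_def U_def z_def by blast
qed

end
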